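(* For $z\in\mathbb{C}\setminus\mathbb{N}$, let $D(z)=\det\left((I-zT_\perp)(I-zT)^{-1}\right)$ be the relative Fredholm determinant of the pair $(T_\perp,T)$. Then $$D(z)=\mathcal{H}(z)$$ and $$\mathcal{H}(z)=\prod_{n=1}^{\infty}\frac{1-z/\rho_n}{1-z/n}.$$ The product converges locally uniformly away from its poles.
   Context: $\mathbb{N}=\{1,2,\ldots\}$. The Gregory coefficients $(G_n)_{n\ge0}$ are defined by $\frac{z}{\log(1+z)}=\sum_{n=0}^{\infty}G_nz^n$ for $|z|<1$; they satisfy $\sum_{n\ge1}|G_n|=1$. The Gregory function is the entire function $\mathcal{G}(z)=\frac{1}{\Gamma(z+1)}\int_0^1\frac{\Gamma(x+1)}{\Gamma(x-z+1)}\,dx$ (with $1/\Gamma$ entire), and the completed Gregory transform is $\mathcal{H}(z)=\frac{\pi z}{\sin\pi z}\mathcal{G}(z)$, regarded as a holomorphic function on $\mathbb{C}\setminus\mathbb{N}$ (the singularities at nonpositive integers are removable). For each $n\ge1$, $\rho_n$ denotes the unique zero of $\mathcal{H}$ (equivalently of $\mathcal{G}$) in the interval $(n,n+1)$. On the Hilbert space $\ell^2(\mathbb{N})$ with standard orthonormal basis $(e_n)_{n\ge1}$, let $T$ be the bounded diagonal operator $Te_n=\frac1n e_n$, and let $u=\sum_{n=1}^{\infty}\sqrt{|G_n|}\,e_n$, a unit vector. Let $Q$ be the orthogonal projection onto $\mathbb{C}u$, $P=I-Q$, and $T_\perp=PTP$. For $z\notin\mathbb{N}$, the operator $(I-zT_\perp)(I-zT)^{-1}=I+z(T-T_\perp)(I-zT)^{-1}$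 differs from the identity by a finite-rank operator, because $T-T_\perp=QT+TQ-QTQ$; $\det$ is the Fredholm determinant. *)

theory Defs
  imports "HOL-Complex_Analysis.Complex_Analysis" "HOL-Combinatorics.Permutations"
begin

text \<open>The point \<open>z = 0\<close> is left out because \<open>z / log (1 + z)\<close> is only defined there by
  continuation; the coefficients are determined by the punctured disc.\<close>
definition gregory_coeff :: "nat \<Rightarrow> real" where
  "gregory_coeff = (THE g. \<forall>z::complex. 0 < cmod z \<and> cmod z < 1 \<longrightarrow>
     (\<lambda>n. of_real (g n) * z ^ n) sums (z / Ln (1 + z)))"

definition gregory_fun :: "complex \<Rightarrow> complex" where
  "gregory_fun z = rGamma (z + 1) *
     integral {0..1} (\<lambda>x::real. Gamma (of_real x + 1) * rGamma (of_real x - z + 1))"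

text \<open>The quotient has removable singularities at the nonpositive integers, which
  \<^const>\<open>remove_sings\<close> fills in by the limit; only the values off the positive integers are
  meaningful.\<close>
definition gregory_transform :: "complex \<Rightarrow> complex" where
  "gregory_transform =
     remove_sings (\<lambda>z. of_real pi * z / sin (of_real pi * z) * gregory_fun z)"

definition gregory_zero :: "nat \<Rightarrow> real" where
  "gregory_zero n =
     (THE x. real n < x \<and> x < real n + 1 \<and> gregory_transform (of_real x) = 0)"

text \<open>Sequences are functions on \<^typ>\<open>nat\<close> vanishing at the unused index 0. Operators are
  functions on sequences that are only meaningful on \<open>ell2\<close>.\<close>
definition ell2 :: "(nat \<Rightarrow> complex) set" where
  "ell2 = {x. x 0 = 0 \<and> (\<lambda>n. (cmod (x n))\<^sup>2) summable_on {1..}}"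

definition ell2_inner :: "(nat \<Rightarrow> complex) \<Rightarrow> (nat \<Rightarrow> complex) \<Rightarrow> complex" where
  "ell2_inner x y = (\<Sum>\<^sub>\<infinity>n\<in>{1..}. cnj (x n) * y n)"

definition ell2_basis :: "nat \<Rightarrow> nat \<Rightarrow> complex" where
  "ell2_basis n = (\<lambda>m. if m = n then 1 else 0)"

definition orth_proj :: "(nat \<Rightarrow> complex) set \<Rightarrow> (nat \<Rightarrow> complex) \<Rightarrow> (nat \<Rightarrow> complex)" where
  "orth_proj M x = (THE y. y \<in> M \<and> (\<forall>w\<in>M. ell2_inner w (x - y) = 0))"

definition minor :: "nat set \<Rightarrow> (nat \<Rightarrow> nat \<Rightarrow> complex) \<Rightarrow> complex" where
  "minor S M = (\<Sum>p | p permutes S. of_int (sign p) * (\<Prod>i\<in>S. M i (p i)))"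

text \<open>This is \<open>det (I + K) = (\<Sum>k. tr (\<Lambda>\<^sup>k K))\<close>, where the trace of the exterior power is taken
  in the orthonormal basis of wedge products of the standard basis, so it is the sum of all
  \<open>k\<close>-by-\<open>k\<close> principal minors of the matrix of \<open>K\<close>. Both sums converge
  absolutely when \<open>K\<close> is of trace class, in particular when it is of finite rank. The argument
  is the full operator \<open>A = I + K\<close>.\<close>
definition fredholm_det :: "((nat \<Rightarrow> complex) \<Rightarrow> (nat \<Rightarrow> complex)) \<Rightarrow> complex" where
  "fredholm_det A =
     (\<Sum>k. \<Sum>\<^sub>\<infinity>S\<in>{S. S \<subseteq> {1..} \<and> finite S \<and> card S = k}.
        minor S (\<lambda>i j. ell2_inner (ell2_basis i) (A (ell2_basis j) - ell2_basis j)))"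

definition opT :: "(nat \<Rightarrow> complex) \<Rightarrow> (nat \<Rightarrow> complex)" where
  "opT x = (\<lambda>n. x n / of_nat n)"

definition vec_u :: "nat \<Rightarrow> complex" where
  "vec_u n = (if n = 0 then 0 else of_real (sqrt \<bar>gregory_coeff n\<bar>))"

definition opQ :: "(nat \<Rightarrow> complex) \<Rightarrow> (nat \<Rightarrow> complex)" where
  "opQ = orth_proj (range (\<lambda>c n. c * vec_u n))"

definition opP :: "(nat \<Rightarrow> complex) \<Rightarrow> (nat \<Rightarrow> complex)" where
  "opP x = x - opQ x"

definition opT_perp :: "(nat \<Rightarrow> complex) \<Rightarrow> (nat \<Rightarrow> complex)" where
  "opT_perp = opP \<circ> opT \<circ> opP"

definition id_minus :: "complex \<Rightarrow> ((nat \<Rightarrow> complex) \<Rightarrow> (nat \<Rightarrow> complex)) \<Rightarrow>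
    (nat \<Rightarrow> complex) \<Rightarrow> (nat \<Rightarrow> complex)" where
  "id_minus z A x = (\<lambda>n. x n - z * A x n)"

definition relative_det :: "complex \<Rightarrow> complex" where
  "relative_det z = fredholm_det (id_minus z opT_perp \<circ> inv_into ell2 (id_minus z opT))"

end

theory Submission
  imports Defs
begin

text \<open>Put \<open>w\<^sub>n = \<bar>G\<^sub>n\<bar>\<close> and \<open>S(z) = (\<Sum>n. w\<^sub>n n / (n - z))\<close>; all three objects are equal to \<open>S\<close>.

  For the transform, \<open>G\<^sub>n\<close> is the integral over \<open>0 \<le> x \<le> 1\<close> of the binomial coefficient \<open>x\<close> over \<open>n\<close>, so
  that \<open>w\<^sub>n\<close> is the integral of the nonnegative weights \<open>b\<^sub>n(x) = - (- 1)\<^sup>n (x gchoose n)\<close>. For fixed \<open>x\<close>,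
  expanding \<open>(1 - t)\<close> to the power \<open>x\<close> in a Beta integral gives
  \<open>(\<Sum>n. b\<^sub>n(x) n / (n - z)) = \<Gamma>(1 - z) \<Gamma>(1 + x) / \<Gamma>(1 + x - z)\<close> for \<open>z < -1\<close>, hence everywhere by
  analytic continuation; integrate over \<open>x\<close> and use the reflection formula.

  For the determinant, \<open>z (T - T\<^sub>\<bottom>)\<close> times the inverse of \<open>I - z T\<close> has rank two, so only principal
  minors of size at most two contribute; these are polynomials in the moments
  \<open>m\<^sub>k = (\<Sum>n. w\<^sub>n d\<^sub>n / n\<^sup>k)\<close>, \<open>d\<^sub>n = z / (1 - z / n)\<close>, and the determinant collapses to \<open>1 + m\<^sub>1 = S(z)\<close>.

  For the product, truncate the series at \<open>N\<close>. The truncation is a rational function, determined by its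
  interlacing zeros and its value at \<open>0\<close>. These zeros converge to those of \<open>S\<close>, and interlacing bounds
  the \<open>n\<close>-th factor minus \<open>1\<close> by a constant times \<open>1 / n - 1 / (n + 1)\<close>, so Tannery's theorem applies.\<close>

section \<open>Products and partial fractions\<close>

text \<open>Exchanging the factors one at a time costs \<open>norm (a i - b i)\<close> times bounds
  for the other factors. Each missing bound \<open>1 + c i\<close> is at least one, so inserting it
  makes the prefactor the same for every \<open>i\<close>.\<close>

lemma norm_prod_diff_le:
  fixes a b :: "'i \<Rightarrow> 'a::{real_normed_field}"
  assumes "finite A" and "\<And>i. i \<in> A \<Longrightarrow> norm (a i) \<le> 1 + c i" "\<And>i. i \<in> A \<Longrightarrow> norm (b i) \<le> 1 + c i"
    "\<And>i. i \<in> A \<Longrightarrow> c i \<ge> 0"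
  shows "norm (prod a A - prod b A) \<le> (\<Prod>i\<in>A. 1 + c i) * (\<Sum>i\<in>A. norm (a i - b i))"
  using assms
proof (induction A)
  case (insert x A)
  let ?P = "\<Prod>i\<in>A. 1 + c i" and ?S = "\<Sum>i\<in>A. norm (a i - b i)"
  have P: "?P \<ge> 0"
    using insert.prems(3) by (intro prod_nonneg) (simp add: add_nonneg_nonneg)
  have "norm (prod b A) \<le> ?P"
    unfolding prod_norm[symmetric] using insert.prems(2) by (intro prod_mono) auto
  then have 1: "norm ((a x - b x) * prod b A) \<le> norm (a x - b x) * ?P"
    unfolding norm_mult by (intro mult_left_mono) auto
  have 2: "norm (a x * (prod a A - prod b A)) \<le> (1 + c x) * (?P * ?S)"
    unfolding norm_mult using insert by (intro mult_mono) auto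
  have "prod a (insert x A) - prod b (insert x A)
      = a x * (prod a A - prod b A) + (a x - b x) * prod b A"
    using insert.hyps by (simp add: algebra_simps)
  then have "norm (prod a (insert x A) - prod b (insert x A))
      \<le> (1 + c x) * (?P * ?S) + norm (a x - b x) * ?P"
    using order_trans[OF norm_triangle_ineq add_mono[OF 2 1]] by simp
  also have "norm (a x - b x) * ?P \<le> (1 + c x) * (norm (a x - b x) * ?P)"
    using P insert.prems(3)[of x] mult_right_mono[of 1 "1 + c x" "norm (a x - b x) * ?P"] by simp
  finally show ?case
    using insert.hyps by (simp add: algebra_simps)
qed simp

text \<open>Dominated convergence for products whose factors and length vary together: the
  difference is at most \<open>exp (suminf c)\<close> times the sum of the factor differences, to
  which Tannery's theorem for series applies. Being about a difference, it lets a limit known for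
  one product pass to the other.\<close>

lemma tannery_prod:
  fixes f :: "nat \<Rightarrow> nat \<Rightarrow> 'a::{real_normed_field, banach}"
  assumes lim: "\<And>k. (\<lambda>N. f N k) \<longlonglongrightarrow> g k"
    and fb: "\<And>N k. k < N \<Longrightarrow> norm (f N k - 1) \<le> c k" and gb: "\<And>k. norm (g k - 1) \<le> c k"
    and c: "summable c"
  shows "(\<lambda>N. (\<Prod>k<N. f N k) - (\<Prod>k<N. g k)) \<longlonglongrightarrow> 0"
proof -
  have c0: "c k \<ge> 0" for k
    using gb[of k] norm_ge_zero order_trans by blast
  \<comment> \<open>The cut at \<open>k < N\<close> turns the finite sums into full series;
    \<open>fb\<close> controls \<open>f N k\<close> only in that range.\<close>
  define h where "h k N = (if k < N then norm (f N k - g k) else 0)" for k N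
  have "(\<lambda>N. \<Sum>k. h k N) \<longlonglongrightarrow> (\<Sum>k. 0)"
  proof (rule tannerys_theorem[THEN conjunct2, THEN conjunct2])
    show "(\<lambda>N. h k N) \<longlonglongrightarrow> 0" for k
    proof (rule Lim_transform_eventually)
      show "(\<lambda>N. norm (f N k - g k)) \<longlonglongrightarrow> 0"
        using tendsto_norm_zero[OF LIM_zero[OF lim[of k]]] .
      show "\<forall>\<^sub>F N in sequentially. norm (f N k - g k) = h k N"
        using eventually_gt_at_top[of k] by eventually_elim (simp add: h_def)
    qed
    have "norm (h k N) \<le> 2 * c k" for k N
      using fb[of k N] gb[of k] c0[of k] norm_triangle_ineq4[of "f N k - 1" "g k - 1"]
      by (auto simp: h_def)
    then show "\<forall>\<^sub>F (k, N) in at_top \<times>\<^sub>F sequentially. norm (h k N) \<le> 2 * c k"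
      by (intro always_eventually) auto
    show "summable (\<lambda>k. 2 * c k)"
      by (intro summable_mult c)
  qed simp
  moreover have "(\<Sum>k. h k N) = (\<Sum>k<N. norm (f N k - g k))" for N
    using suminf_finite[of "{..<N}" "\<lambda>k. h k N"] by (simp add: h_def)
  ultimately have "(\<lambda>N. exp (suminf c) * (\<Sum>k<N. norm (f N k - g k))) \<longlonglongrightarrow> exp (suminf c) * 0"
    by (intro tendsto_mult_left) simp
  then have "(\<lambda>N. exp (suminf c) * (\<Sum>k<N. norm (f N k - g k))) \<longlonglongrightarrow> 0"
    by simp
  then show ?thesis
  proof (rule Lim_null_comparison[rotated], intro always_eventually allI)
    fix N
    have bd: "norm y \<le> 1 + c k" if "norm (y - 1) \<le> c k" for y :: 'a and k
      using that norm_triangle_ineq[of "y - 1" 1] by simp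
    have "norm ((\<Prod>k<N. f N k) - (\<Prod>k<N. g k)) \<le> (\<Prod>k<N. 1 + c k) * (\<Sum>k<N. norm (f N k - g k))"
      using c0 by (intro norm_prod_diff_le bd fb gb) auto
    also have "(\<Prod>k<N. 1 + c k) \<le> (\<Prod>k<N. exp (c k))"
      using c0 by (intro prod_mono) (auto simp: add_nonneg_nonneg)
    also have "\<dots> = exp (\<Sum>k<N. c k)"
      by (simp add: exp_sum)
    also have "\<dots> \<le> exp (suminf c)"
      using sum_le_suminf[OF c, of "{..<N}"] c0 by simp
    finally show "norm ((\<Prod>k<N. f N k) - (\<Prod>k<N. g k)) \<le> exp (suminf c) * (\<Sum>k<N. norm (f N k - g k))"
      by (simp add: mult_right_mono sum_nonneg)
  qed
qed

text \<open>Both sides, multiplied out, are polynomials in \<open>z\<close> of degree at most \<open>card R\<close> that agree on \<open>insert 0 R\<close>.\<close>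
lemma partial_fraction_product:
  fixes z :: "'a::field_char_0"
  assumes K: "finite K" and R: "card R + 1 = card K" "0 \<notin> K" "0 \<notin> R"
    and disj: "K \<inter> R = {}"
    and zeros: "\<And>r. r \<in> R \<Longrightarrow> (\<Sum>k\<in>K. c k * (k / (k - r))) = 0" and z: "z \<notin> K"
    and fin: "finite R"
  shows "(\<Sum>k\<in>K. c k * (k / (k - z))) * (\<Prod>k\<in>K. 1 - z / k) = (\<Sum>k\<in>K. c k) * (\<Prod>r\<in>R. 1 - z / r)"
proof -
  define p where "p = (\<Sum>k\<in>K. smult (c k) (\<Prod>j\<in>K - {k}. [:1, - 1 / j:]))"
  define q where "q = smult (\<Sum>k\<in>K. c k) (\<Prod>r\<in>R. [:1, - 1 / r:])"
  have deg: "degree (\<Prod>j\<in>A. [:1, - 1 / j:]) \<le> card A" if "finite A" for A :: "'a set"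
    using that degree_prod_sum_le[of A "\<lambda>j. [:1, - 1 / j:]"] sum_mono[of A "\<lambda>j. degree [:1, - 1 / j:]" "\<lambda>_. 1"]
    by force
  have poly_p: "poly p y = (\<Sum>k\<in>K. c k * (k / (k - y))) * (\<Prod>k\<in>K. 1 - y / k)" if "y \<notin> K" for y
    unfolding p_def poly_sum sum_distrib_right
  proof (rule sum.cong[OF refl])
    fix k assume k: "k \<in> K"
    then have "k \<noteq> 0" "k \<noteq> y"
      using R that by auto
    then have "k / (k - y) * (1 - y / k) = 1"
      by (simp add: field_simps)
    then have "c k * (k / (k - y)) * (\<Prod>k\<in>K. 1 - y / k) = c k * (\<Prod>j\<in>K - {k}. 1 - y / j)"
      unfolding prod.remove[OF K k] by (metis (no_types, lifting) mult.assoc mult_1)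
    then show "poly (smult (c k) (\<Prod>j\<in>K - {k}. [:1, - 1 / j:])) y
        = c k * (k / (k - y)) * (\<Prod>k\<in>K. 1 - y / k)"
      by (simp add: poly_prod)
  qed
  have "p = q"
  proof (rule poly_eqI_degree[where A = "insert 0 R"])
    have "degree p \<le> card R"
      unfolding p_def
    proof (rule degree_sum_le[OF K])
      fix k assume "k \<in> K"
      then show "degree (smult (c k) (\<Prod>j\<in>K - {k}. [:1, - 1 / j:])) \<le> card R"
        using deg[of "K - {k}"] degree_smult_le[of "c k"] K R(1)
        by (metis Diff_empty add_diff_cancel_right' card_Diff_singleton finite_Diff order_trans)
    qed
    then show "degree p < card (insert 0 R)"
      using fin R by simp
    have "degree q \<le> card R"
      unfolding q_def using deg[OF fin] degree_smult_le order_trans by blast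
    then show "degree q < card (insert 0 R)"
      using fin R by simp
    fix y assume "y \<in> insert 0 R"
    then consider "y = 0" | "y \<in> R"
      by blast
    then show "poly p y = poly q y"
    proof cases
      case 1
      then show ?thesis
        by (simp add: p_def q_def poly_sum poly_prod)
    next
      case 2
      then have "(\<Prod>r\<in>R. 1 - y / r) = 0"
        using fin R(3) by (intro prod_zero) auto
      moreover have "y \<notin> K"
        using disj 2 by blast
      ultimately show ?thesis
        using zeros[OF 2] poly_p[of y] by (simp add: q_def poly_prod)
    qed
  qed
  then show ?thesis
    using poly_p[OF z] by (simp add: q_def poly_prod)
qed

section \<open>Discrete Stieltjes transforms\<close>

text \<open>The term at \<open>n = 0\<close> vanishes, also for \<open>z = 0\<close> where it is \<open>0 / 0\<close>; hence \<open>w 0\<close> plays no role.\<close>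
definition stieltjes :: "(nat \<Rightarrow> real) \<Rightarrow> 'a \<Rightarrow> 'a::{real_normed_field, banach}" where
  "stieltjes w z = (\<Sum>n. of_real (w n) * (of_nat n / (of_nat n - z)))"

text \<open>Write \<open>n / (n - y) = 1 + y / (n - y)\<close>. The positive integers form a closed
  set, so a small closed ball around \<open>z\<close> keeps a fixed distance from all of them and
  the bound is uniform in \<open>n\<close>. It feeds every domination argument for the
  transform.\<close>

lemma kernel_bound:
  fixes z :: "'a::real_normed_field"
  assumes "z \<notin> of_nat ` {1..}"
  obtains d C where "d > 0" "cball z d \<inter> of_nat ` {1..} = {}"
    "\<And>n y. y \<in> cball z d \<Longrightarrow> norm (of_nat n / (of_nat n - y)) \<le> C"
proof -
  have "open (- (of_nat ` {1..} :: 'a set))"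
    by (rule open_Compl[OF closed_of_nat_image])
  then obtain e where e: "e > 0" "ball z e \<subseteq> - of_nat ` {1..}"
    using assms by (meson ComplI openE)
  have far: "e / 2 \<le> norm (of_nat n - y)" if "y \<in> cball z (e / 2)" "n \<ge> 1" for n y
  proof -
    have "(of_nat n :: 'a) \<notin> ball z e"
      using e that by auto
    then have "e \<le> norm (of_nat n - z)"
      by (simp add: dist_norm norm_minus_commute)
    also have "\<dots> \<le> norm (of_nat n - y) + norm (y - z)"
      using norm_triangle_ineq[of "of_nat n - y" "y - z"] by simp
    also have "norm (y - z) \<le> e / 2"
      using that by (simp add: dist_norm norm_minus_commute)
    finally show ?thesis
      by simp
  qed
  have "norm (of_nat n / (of_nat n - y)) \<le> 1 + (norm z + e / 2) / (e / 2)"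
    if y: "y \<in> cball z (e / 2)" for n y
  proof (cases "n = 0")
    case False
    then have n: "e / 2 \<le> norm (of_nat n - y)"
      using far[OF y] by simp
    then have "of_nat n - y \<noteq> 0"
      using e by auto
    then have "of_nat n / (of_nat n - y) = 1 + y / (of_nat n - y)"
      by (simp add: field_simps)
    also have "norm \<dots> \<le> 1 + norm y / norm (of_nat n - y)"
      using norm_triangle_ineq[of 1 "y / (of_nat n - y)"] by (simp add: norm_divide)
    also have "norm y \<le> norm z + e / 2"
      using y norm_triangle_ineq[of z "y - z"] by (simp add: dist_norm norm_minus_commute)
    then have "norm y / norm (of_nat n - y) \<le> (norm z + e / 2) / (e / 2)"
      using n e by (intro frac_le) auto
    finally show ?thesis
      by simp
  qed (use e in auto)
  moreover have "cball z (e / 2) \<inter> of_nat ` {1..} = {}"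
    using e by (force simp: subset_iff)
  ultimately show ?thesis
    using that[of "e / 2" "1 + (norm z + e / 2) / (e / 2)"] e by auto
qed

lemma not_nat_between: "real n < x \<Longrightarrow> x < real n + 1 \<Longrightarrow> x \<notin> of_nat ` A"
proof
  assume x: "real n < x" "x < real n + 1" and "x \<in> of_nat ` A"
  then obtain m where "x = real m"
    by blast
  then have "real n < real m" "real m < real (n + 1)"
    using x by simp_all
  then show False
    unfolding of_nat_less_iff by simp
qed

section \<open>Nonnegative summable weights: regularity, monotonicity and zeros of the
  transform\<close>

locale weights =
  fixes w :: "nat \<Rightarrow> real"
  assumes nonneg: "w n \<ge> 0" and summable_w: "summable w"
begin

lemma stieltjes_uniform:
  fixes A :: "'a::{real_normed_field, banach} set"
  assumes "\<And>n y. y \<in> A \<Longrightarrow> norm (of_nat n / (of_nat n - y) :: 'a) \<le> C"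
  shows "uniform_limit A (\<lambda>N y. \<Sum>n<N. of_real (w n) * (of_nat n / (of_nat n - y)))
    (stieltjes w) sequentially"
  unfolding stieltjes_def
proof (rule Weierstrass_m_test)
  show "norm (of_real (w n) * (of_nat n / (of_nat n - y)) :: 'a) \<le> w n * C" if "y \<in> A" for n y
    unfolding norm_mult norm_of_real abs_of_nonneg[OF nonneg]
    by (intro mult_left_mono assms nonneg that)
  show "summable (\<lambda>n. w n * C)"
    by (rule summable_mult2[OF summable_w])
qed

lemma summable_norm_stieltjes:
  fixes z :: "'a::{real_normed_field, banach}"
  assumes "z \<notin> of_nat ` {1..}"
  shows "summable (\<lambda>n. norm (of_real (w n) * (of_nat n / (of_nat n - z))))"
proof -
  obtain d C where d: "d > 0" "cball z d \<inter> of_nat ` {1..} = {}"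
    "\<And>n y. y \<in> cball z d \<Longrightarrow> norm (of_nat n / (of_nat n - y)) \<le> C"
    using kernel_bound[OF assms] by blast
  have "norm (of_real (w n) * (of_nat n / (of_nat n - z))) \<le> w n * C" for n
    unfolding norm_mult norm_of_real abs_of_nonneg[OF nonneg] using d(1)
    by (intro mult_left_mono d(3) nonneg) simp
  then show ?thesis
    by (intro summable_comparison_test'[OF summable_mult2[OF summable_w, of C], of 0])
      (simp only: real_norm_def abs_norm_cancel)
qed

lemma sums_stieltjes:
  fixes z :: "'a::{real_normed_field, banach}"
  assumes "z \<notin> of_nat ` {1..}"
  shows "(\<lambda>n. of_real (w n) * (of_nat n / (of_nat n - z))) sums stieltjes w z"
  unfolding stieltjes_def
  by (intro summable_sums summable_norm_cancel[OF summable_norm_stieltjes] assms)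

lemma continuous_stieltjes:
  fixes z :: "'a::{real_normed_field, banach}"
  assumes "z \<notin> of_nat ` {1..}"
  shows "isCont (stieltjes w) z"
proof -
  obtain d C where d: "d > 0" "cball z d \<inter> of_nat ` {1..} = {}"
    "\<And>n y. y \<in> cball z d \<Longrightarrow> norm (of_nat n / (of_nat n - y)) \<le> C"
    using kernel_bound[OF assms] by blast
  have "continuous_on (cball z d) (stieltjes w)"
  proof (rule uniform_limit_theorem[OF _ stieltjes_uniform[OF d(3)]])
    have "continuous_on (cball z d) (\<lambda>y. of_real (w n) * (of_nat n / (of_nat n - y)))" for n
    \<comment> \<open>The term with \<open>n = 0\<close> is constantly zero, but its denominator may
      vanish in the ball, so it is treated apart.\<close>
    proof (cases "n = 0")
      case False
      then have "(of_nat n :: 'a) \<in> of_nat ` {1..}"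
        by auto
      then have "of_nat n \<notin> cball z d"
        using d(2) by blast
      then show ?thesis
        by (intro continuous_intros) auto
    qed auto
    then show "\<forall>\<^sub>F N in sequentially. continuous_on (cball z d)
        (\<lambda>y. \<Sum>n<N. of_real (w n) * (of_nat n / (of_nat n - y)))"
      by (intro always_eventually allI continuous_on_sum)
  qed auto
  moreover have "z \<in> interior (cball z d)"
    using d(1) by (meson ball_subset_cball centre_in_ball interiorI open_ball)
  ultimately show ?thesis
    by (rule continuous_on_interior)
qed

lemma holomorphic_stieltjes: "stieltjes w holomorphic_on - of_nat ` {1..}"
proof (rule holomorphic_uniform_sequence)
  show "open (- of_nat ` {1..} :: complex set)"
    by (rule open_Compl[OF closed_of_nat_image])
  show "(\<lambda>y. \<Sum>n<N. of_real (w n) * (of_nat n / (of_nat n - y))) holomorphic_on - of_nat ` {1..}"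
    for N :: nat
  proof (rule holomorphic_on_sum)
    fix n
    show "(\<lambda>y. of_real (w n) * (of_nat n / (of_nat n - y))) holomorphic_on - of_nat ` {1..}"
      by (cases "n = 0") (auto intro!: holomorphic_intros)
  qed
next
  fix z :: complex
  assume "z \<in> - of_nat ` {1..}"
  then obtain d C where d: "d > 0" "cball z d \<inter> of_nat ` {1..} = {}"
    "\<And>n y. y \<in> cball z d \<Longrightarrow> norm (of_nat n / (of_nat n - y)) \<le> C"
    using kernel_bound[of z] by blast
  then show "\<exists>d>0. cball z d \<subseteq> - of_nat ` {1..} \<and>
      uniform_limit (cball z d) (\<lambda>N y. \<Sum>n<N. of_real (w n) * (of_nat n / (of_nat n - y)))
        (stieltjes w) sequentially"
    by (intro exI[of _ d] conjI stieltjes_uniform[OF d(3)]) auto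
qed

text \<open>Signs and zeros are studied over the reals, where order is available; this carries them
  to the field in which the product is taken.\<close>

lemma stieltjes_of_real:
  assumes "x \<notin> of_nat ` {1..}"
  shows "stieltjes w (of_real x) = (of_real (stieltjes w x) :: 'a::{real_normed_field, banach})"
proof -
  have "(\<lambda>n. of_real (w n * (of_nat n / (of_nat n - x)))) sums (of_real (stieltjes w x) :: 'a)"
    using sums_stieltjes[OF assms] by (intro sums_of_real) simp
  then show ?thesis
    unfolding stieltjes_def[of w "of_real x"] by (simp add: sums_iff)
qed

text \<open>Termwise, the increment is \<open>w k * k * (y - x) / ((k - x) * (k - y))\<close>. No
  integer lies between \<open>x\<close> and \<open>y\<close>, so both denominator factors have the
  same sign; the term \<open>k = n\<close> is strictly positive.\<close>

lemma stieltjes_strict_mono: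
  assumes w: "w n > 0" and n: "n \<ge> 1" and x: "real n < x" "x < y" "y < real n + 1"
  shows "stieltjes w x < stieltjes w y"
proof -
  define t where "t k = w k * (real k / (real k - y)) - w k * (real k / (real k - x))" for k
  have t: "t k = w k * (real k * (y - x) / ((real k - x) * (real k - y)))"
    and pos: "(real k - x) * (real k - y) > 0" for k
  proof -
    have *: "(real k - x < 0 \<and> real k - y < 0) \<or> (real k - x > 0 \<and> real k - y > 0)"
    proof (cases "k \<le> n")
      case True
      then have "real k \<le> real n"
        by simp
      then show ?thesis
        using x by linarith
    next
      case False
      then have "real n + 1 \<le> real k"
        by linarith
      then show ?thesis
        using x by linarith
    qed
    then show "(real k - x) * (real k - y) > 0"
      by (auto intro: mult_neg_neg)
    have "real k / (real k - y) - real k / (real k - x)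
        = (real k * (real k - x) - real k * (real k - y)) / ((real k - y) * (real k - x))"
      using * by (intro diff_frac_eq) auto
    then have "real k / (real k - y) - real k / (real k - x)
        = real k * (y - x) / ((real k - x) * (real k - y))"
      by (simp add: right_diff_distrib mult.commute)
    then show "t k = w k * (real k * (y - x) / ((real k - x) * (real k - y)))"
      unfolding t_def right_diff_distrib[symmetric] by simp
  qed
  have sums: "t sums (stieltjes w y - stieltjes w x)"
    unfolding t_def using x
      sums_diff[OF sums_stieltjes[of y] sums_stieltjes[of x]]
      not_nat_between[of n x "{1..}"] not_nat_between[of n y "{1..}"] by simp
  have "0 < suminf t"
  proof (rule suminf_pos2)
    show "summable t"
      using sums by (simp add: sums_iff)
    show "0 \<le> t k" for k
      unfolding t using x by (intro mult_nonneg_nonneg divide_nonneg_pos nonneg pos) auto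
    show "0 < t n"
      unfolding t using w n x by (intro mult_pos_pos divide_pos_pos pos) auto
  qed
  then show ?thesis
    using sums by (simp add: sums_iff)
qed

lemma stieltjes_zero_unique:
  assumes "w n > 0" "n \<ge> 1"
    and "real n < x" "x < real n + 1" "stieltjes w x = 0"
    and "real n < y" "y < real n + 1" "stieltjes w y = 0"
  shows "x = y"
  using stieltjes_strict_mono[OF assms(1,2), of x y] stieltjes_strict_mono[OF assms(1,2), of y x]
    assms(3-) by linarith

text \<open>Just right of the pole \<open>n\<close> its own term is
  \<open>- n * w n / (x - n)\<close>. Terms with \<open>k < n\<close> are nonpositive; for
  \<open>k > n\<close> the distance \<open>k - x\<close> is at least \<open>1 / 2\<close>, which
  gives \<open>k / (k - x) \<le> 2 * (n + 1)\<close>.\<close>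

lemma stieltjes_upper:
  assumes n: "n \<ge> 1" and x: "real n < x" "x \<le> real n + 1 / 2"
  shows "stieltjes w x \<le> 2 * (real n + 1) * suminf w - real n * w n / (x - real n)"
proof -
  have S: "(\<lambda>k. w k * (real k / (real k - x))) sums stieltjes w x"
    using sums_stieltjes[of x] not_nat_between[of n x "{1..}"] x by simp
  have "(\<lambda>k. 2 * (real n + 1) * w k - (if k = n then real n * w k / (x - real n) else 0))
      sums (2 * (real n + 1) * suminf w - real n * w n / (x - real n))"
    by (intro sums_diff sums_mult summable_sums[OF summable_w] sums_single)
  from S this show ?thesis
  proof (rule sums_le[rotated])
    fix k
    consider "k < n" | "k = n" | "k \<ge> n + 1"
      by linarith
    then show "w k * (real k / (real k - x))
        \<le> 2 * (real n + 1) * w k - (if k = n then real n * w k / (x - real n) else 0)"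
    proof cases
      case 1
      then have "real k / (real k - x) \<le> 0"
        using x by (intro divide_nonneg_neg) auto
      then have "w k * (real k / (real k - x)) \<le> 0"
        by (intro mult_nonneg_nonpos nonneg)
      then show ?thesis
        using 1 nonneg[of k] by (simp add: order_trans[of _ 0])
    next
      case 2
      have "w n * (real n / (real n - x)) = - (real n * w n / (x - real n))"
        using x by (simp add: field_simps)
      then show ?thesis
        using 2 nonneg[of k] by simp
    next
      case 3
      then have k: "real k - x \<ge> 1 / 2" "real n + 1 \<le> real k"
        using x by auto
      have "real k / (real k - x) = 1 + x / (real k - x)"
        using k by (simp add: field_simps)
      also have "x / (real k - x) \<le> (real n + 1 / 2) / (1 / 2)"
        using k x by (intro frac_le) auto
      finally have "real k / (real k - x) \<le> 2 * (real n + 1)"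
        by simp
      then have "w k * (real k / (real k - x)) \<le> w k * (2 * (real n + 1))"
        by (intro mult_left_mono nonneg)
      then show ?thesis
        using 3 by (simp add: mult_ac)
    qed
  qed
qed

text \<open>The mirror image just left of the pole \<open>n + 1\<close>: terms beyond it are
  nonnegative, and those with \<open>k \<le> n\<close> are at least
  \<open>- 2 * n * w k\<close>.\<close>

lemma stieltjes_lower:
  assumes x: "real n + 1 / 2 \<le> x" "x < real n + 1"
  shows "stieltjes w x \<ge> (real n + 1) * w (n + 1) / (real n + 1 - x) - 2 * real n * suminf w"
proof -
  have S: "(\<lambda>k. w k * (real k / (real k - x))) sums stieltjes w x"
    using sums_stieltjes[of x] not_nat_between[of n x "{1..}"] x by simp
  have "(\<lambda>k. (if k = n + 1 then (real n + 1) * w k / (real n + 1 - x) else 0) - 2 * real n * w k)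
      sums ((real n + 1) * w (n + 1) / (real n + 1 - x) - 2 * real n * suminf w)"
    by (intro sums_diff sums_mult summable_sums[OF summable_w] sums_single)
  from this S show ?thesis
  proof (rule sums_le[rotated])
    fix k
    consider "k \<le> n" | "k = n + 1" | "k > n + 1"
      by linarith
    then show "(if k = n + 1 then (real n + 1) * w k / (real n + 1 - x) else 0) - 2 * real n * w k
        \<le> w k * (real k / (real k - x))"
    proof cases
      case 1
      then have k: "x - real k \<ge> 1 / 2" "real k \<le> real n"
        using x by auto
      have "real k / (x - real k) \<le> real n / (1 / 2)"
        using k by (intro frac_le) auto
      moreover have "real k / (real k - x) = - (real k / (x - real k))"
        using k by (simp add: field_simps)
      ultimately have "- (2 * real n) \<le> real k / (real k - x)"
        by simp
      then have "w k * - (2 * real n) \<le> w k * (real k / (real k - x))"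
        by (intro mult_left_mono nonneg)
      then show ?thesis
        using 1 by (simp add: mult_ac)
    next
      case 2
      then have "w k * (real k / (real k - x)) = (real n + 1) * w k / (real n + 1 - x)"
        by (simp add: mult.commute add.commute)
      moreover have "0 \<le> 2 * real n * w k"
        using nonneg by simp
      ultimately show ?thesis
        using 2 by simp
    next
      case 3
      then have "0 \<le> real k / (real k - x)"
        using x by (intro divide_nonneg_pos) auto
      then have "0 \<le> w k * (real k / (real k - x))"
        by (intro mult_nonneg_nonneg nonneg)
      then show ?thesis
        using 3 nonneg[of k] by (simp add: order_trans[of _ 0])
    qed
  qed
qed

text \<open>The transform is nonpositive near the left pole and nonnegative near the right one, so
  the intermediate value theorem applies. Positivity is asked only at these two poles, so that
  truncated weights qualify.\<close>

lemma ex_stieltjes_zero: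
  assumes n: "n \<ge> 1" and w: "w n > 0" "w (n + 1) > 0"
  obtains x where "real n < x" "x < real n + 1" "stieltjes w x = 0"
proof -
  let ?W = "suminf w"
  have W: "?W \<ge> 0"
    by (intro suminf_nonneg summable_w nonneg)
  \<comment> \<open>At distance \<open>d\<close> or \<open>e\<close> from its pole, the polar term
    exceeds the bound on all other terms by at least one. The summand \<open>+ 1\<close> also keeps
    the denominators positive given only \<open>?W \<ge> 0\<close>, and the minimum with
    \<open>1 / 2\<close> stays within the range of the two estimates.\<close>
  define d where "d = min (1 / 2) (real n * w n / (2 * (real n + 1) * ?W + 1))"
  define e where "e = min (1 / 2) ((real n + 1) * w (n + 1) / (2 * real n * ?W + 1))"
  have p: "2 * (real n + 1) * ?W + 1 > 0" "2 * real n * ?W + 1 > 0"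
    using W by (simp_all add: add_nonneg_pos)
  have d: "d > 0"
    using n w p by (simp add: d_def)
  have d': "d \<le> 1 / 2" "d \<le> real n * w n / (2 * (real n + 1) * ?W + 1)"
    unfolding d_def by (rule min.cobounded1 min.cobounded2)+
  have e: "e > 0"
    using n w p by (simp add: e_def)
  have e': "e \<le> 1 / 2" "e \<le> (real n + 1) * w (n + 1) / (2 * real n * ?W + 1)"
    unfolding e_def by (rule min.cobounded1 min.cobounded2)+
  have "2 * (real n + 1) * ?W + 1 \<le> real n * w n / d"
    using d'(2) unfolding pos_le_divide_eq[OF p(1)] pos_le_divide_eq[OF d] by (simp only: mult.commute)
  moreover have "stieltjes w (real n + d) \<le> 2 * (real n + 1) * ?W - real n * w n / d"
    using stieltjes_upper[OF n, of "real n + d"] d d'(1) by simp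
  ultimately have neg: "stieltjes w (real n + d) \<le> 0"
    by simp
  have "2 * real n * ?W + 1 \<le> (real n + 1) * w (n + 1) / e"
    using e'(2) unfolding pos_le_divide_eq[OF p(2)] pos_le_divide_eq[OF e] by (simp only: mult.commute)
  moreover have "(real n + 1) * w (n + 1) / e - 2 * real n * ?W \<le> stieltjes w (real n + 1 - e)"
    using stieltjes_lower[of n "real n + 1 - e"] e e'(1) by simp
  ultimately have pos: "0 \<le> stieltjes w (real n + 1 - e)"
    by simp
  have "continuous_on {real n + d..real n + 1 - e} (stieltjes w)"
  proof (intro continuous_at_imp_continuous_on ballI continuous_stieltjes)
    show "x \<notin> of_nat ` {1..}" if "x \<in> {real n + d..real n + 1 - e}" for x :: real
      using that d e by (intro not_nat_between[of n]) auto
  qed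
  then obtain x where "real n + d \<le> x" "x \<le> real n + 1 - e" "stieltjes w x = 0"
    using IVT'[of "stieltjes w" "real n + d" 0 "real n + 1 - e"] neg pos d'(1) e'(1) by auto
  then show ?thesis
    using d e by (intro that[of x]) auto
qed

end

text \<open>The left side is the norm of \<open>z * (1 / n - 1 / r) * (n / (n - z))\<close>, and
  \<open>r\<close> lies between \<open>n\<close> and \<open>n + 1\<close>. The resulting bound
  telescopes and does not depend on \<open>r\<close>, so it serves the zeros of all truncations as
  well as those of the limit.\<close>

lemma factor_bound:
  fixes z :: "'a::real_normed_field"
  assumes z: "z \<notin> of_nat ` {1..}" and n: "n \<ge> 1" and r: "real n < r" "r < real n + 1"
    and C: "norm (of_nat n / (of_nat n - z)) \<le> C"
  shows "norm ((1 - z / of_real r) / (1 - z / of_nat n) - 1) \<le> norm z * C * (1 / real n - 1 / real (Suc n))"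
proof -
  have nz: "of_nat n - z \<noteq> 0" "(of_nat n :: 'a) \<noteq> 0" "(of_real r :: 'a) \<noteq> 0"
    using z n r by auto
  have "1 - z / of_nat n = (of_nat n - z) / of_nat n"
    using nz by (simp add: diff_divide_distrib)
  then have "(1 - z / of_real r) / (1 - z / of_nat n) - 1
      = ((1 - z / of_real r) - (1 - z / of_nat n)) * (of_nat n / (of_nat n - z))"
    using nz by (simp add: divide_simps)
  also have "(1 - z / of_real r) - (1 - z / of_nat n) = z * of_real (1 / real n - 1 / r)"
    by (simp add: algebra_simps)
  finally have "norm ((1 - z / of_real r) / (1 - z / of_nat n) - 1)
      = norm z * \<bar>1 / real n - 1 / r\<bar> * norm (of_nat n / (of_nat n - z))"
    by (simp only: norm_mult norm_of_real)
  also have "\<dots> \<le> norm z * (1 / real n - 1 / real (Suc n)) * C"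
  proof (intro mult_mono C)
    have "1 / r \<le> 1 / real n" "1 / real (Suc n) \<le> 1 / r"
      using n r by (auto intro!: divide_left_mono)
    then show "\<bar>1 / real n - 1 / r\<bar> \<le> 1 / real n - 1 / real (Suc n)"
      by linarith
    show "0 \<le> norm z * (1 / real n - 1 / real (Suc n))"
      using n by (intro mult_nonneg_nonneg) (auto intro!: divide_left_mono)
  qed auto
  finally show ?thesis
    by (simp only: mult_ac)
qed

lemma summable_factor_bound: "summable (\<lambda>k. B * (1 / real (Suc k) - 1 / real (Suc (Suc k))))"
  by (intro summable_mult telescope_summable'[of _ 0]) (use LIMSEQ_inverse_real_of_nat in \<open>simp add: inverse_eq_divide\<close>)

section \<open>Positive weights of total mass one: zeros, truncations and the infinite
  product\<close>

locale prob_weights =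
  fixes w :: "nat \<Rightarrow> real"
  assumes w_0: "w 0 = 0" and w_pos: "n \<ge> 1 \<Longrightarrow> w n > 0" and w_sums: "w sums 1"
begin

sublocale weights w
proof
  show "w n \<ge> 0" for n
    using w_0 w_pos[of n] by (cases n) (auto intro: less_imp_le)
  show "summable w"
    using w_sums by (rule sums_summable)
qed

definition zero :: "nat \<Rightarrow> real" where
  "zero n = (THE x. real n < x \<and> x < real n + 1 \<and> stieltjes w x = 0)"

lemma zero:
  assumes n: "n \<ge> 1"
  shows "real n < zero n" "zero n < real n + 1" "stieltjes w (zero n) = 0"
proof -
  have "\<exists>!x. real n < x \<and> x < real n + 1 \<and> stieltjes w x = 0"
    using ex_stieltjes_zero[of n] stieltjes_zero_unique[of n] n w_pos[of n] w_pos[of "n + 1"]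
    by (intro ex_ex1I) (metis le_add2, blast)
  from theI'[OF this] show "real n < zero n" "zero n < real n + 1" "stieltjes w (zero n) = 0"
    unfolding zero_def by auto
qed

text \<open>A weight sequence again, but with zeros in its tail; the truncations therefore interpret
  \<open>weights\<close> and not \<open>prob_weights\<close>.\<close>

definition trunc :: "nat \<Rightarrow> nat \<Rightarrow> real" where
  "trunc m k = (if k \<le> m then w k else 0)"

lemma weights_trunc: "weights (trunc m)"
proof
  show "trunc m n \<ge> 0" for n
    using nonneg by (simp add: trunc_def)
  show "summable (trunc m)"
    by (rule summable_finite[of "{..m}"]) (auto simp: trunc_def)
qed

lemma stieltjes_trunc:
  "stieltjes (trunc m) z = (\<Sum>k=1..m. of_real (w k) * (of_nat k / (of_nat k - z)))"
proof -
  have "stieltjes (trunc m) z = (\<Sum>k=1..m. of_real (trunc m k) * (of_nat k / (of_nat k - z)))"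
    unfolding stieltjes_def by (rule suminf_finite) (auto simp: trunc_def not_le)
  then show ?thesis
    by (simp add: trunc_def)
qed

lemma stieltjes_trunc_tendsto:
  fixes z :: "'a::{real_normed_field, banach}"
  assumes "z \<notin> of_nat ` {1..}"
  shows "(\<lambda>m. stieltjes (trunc m) z) \<longlonglongrightarrow> stieltjes w z"
proof -
  have "(\<lambda>m. \<Sum>k\<le>m. of_real (w k) * (of_nat k / (of_nat k - z))) \<longlonglongrightarrow> stieltjes w z"
    using sums_stieltjes[OF assms] by (simp add: sums_def_le)
  moreover have "(\<Sum>k\<le>m. of_real (w k) * (of_nat k / (of_nat k - z))) = stieltjes (trunc m) z" for m
    unfolding stieltjes_trunc atMost_atLeast0 by (subst sum.atLeast_Suc_atMost) auto
  ultimately show ?thesis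
    by simp
qed

definition trunc_zero :: "nat \<Rightarrow> nat \<Rightarrow> real" where
  "trunc_zero m n = (SOME x. real n < x \<and> x < real n + 1 \<and> stieltjes (trunc m) x = 0)"

lemma trunc_zero:
  assumes n: "n \<ge> 1" "n < m"
  shows "real n < trunc_zero m n" "trunc_zero m n < real n + 1" "stieltjes (trunc m) (trunc_zero m n) = 0"
proof -
  interpret T: weights "trunc m"
    by (rule weights_trunc)
  have "\<exists>x. real n < x \<and> x < real n + 1 \<and> stieltjes (trunc m) x = 0"
    using T.ex_stieltjes_zero[of n] n w_pos[of n] w_pos[of "n + 1"]
    by (simp add: trunc_def) metis
  from someI_ex[OF this] show "real n < trunc_zero m n" "trunc_zero m n < real n + 1"
      "stieltjes (trunc m) (trunc_zero m n) = 0"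
    unfolding trunc_zero_def by auto
qed

text \<open>At a point \<open>y\<close> between \<open>a\<close> and the limiting zero, the full
  transform has a strict sign, which the truncations eventually share. Since each truncation is
  increasing on the interval, its zero must lie on the other side of \<open>y\<close>.\<close>

lemma trunc_zero_tendsto:
  assumes n: "n \<ge> 1"
  shows "(\<lambda>m. trunc_zero m n) \<longlonglongrightarrow> zero n"
proof (rule order_tendstoI)
  fix a assume a: "a < zero n"
  \<comment> \<open>The maximum with \<open>n\<close> keeps \<open>y\<close> inside the interval
    even if \<open>a\<close> lies to the left of it.\<close>
  define y where "y = (max a (real n) + zero n) / 2"
  have y: "a < y" "real n < y" "y < zero n" "y < real n + 1"
    using a zero[OF n] by (auto simp: y_def)
  have "stieltjes w y < 0"
    using stieltjes_strict_mono[OF w_pos[OF n] n y(2,3)] zero[OF n] by simp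
  then have "\<forall>\<^sub>F m in sequentially. stieltjes (trunc m) y < 0"
    using stieltjes_trunc_tendsto[OF not_nat_between[OF y(2,4)]] by (rule order_tendstoD(2)[rotated])
  then show "\<forall>\<^sub>F m in sequentially. a < trunc_zero m n"
    using eventually_gt_at_top[of n]
  proof eventually_elim
    case (elim m)
    interpret T: weights "trunc m"
      by (rule weights_trunc)
    have pos: "trunc m n > 0"
      using w_pos n elim by (simp add: trunc_def)
    have "\<not> trunc_zero m n \<le> y"
      using T.stieltjes_strict_mono[OF pos n trunc_zero(1)[OF n elim(2)], of y] elim(1) y
        trunc_zero(3)[OF n elim(2)] by fastforce
    then show ?case
      using y by simp
  qed
next
  fix a assume a: "zero n < a"
  define y where "y = (min a (real n + 1) + zero n) / 2"
  have y: "y < a" "y < real n + 1" "zero n < y" "real n < y"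
    using a zero[OF n] by (auto simp: y_def)
  have "stieltjes w y > 0"
    using stieltjes_strict_mono[OF w_pos[OF n] n zero(1)[OF n] y(3,2)] zero[OF n] by simp
  then have "\<forall>\<^sub>F m in sequentially. stieltjes (trunc m) y > 0"
    using stieltjes_trunc_tendsto[OF not_nat_between[OF y(4,2)]] by (rule order_tendstoD(1)[rotated])
  then show "\<forall>\<^sub>F m in sequentially. trunc_zero m n < a"
    using eventually_gt_at_top[of n]
  proof eventually_elim
    case (elim m)
    interpret T: weights "trunc m"
      by (rule weights_trunc)
    have pos: "trunc m n > 0"
      using w_pos n elim by (simp add: trunc_def)
    have "\<not> y \<le> trunc_zero m n"
      using T.stieltjes_strict_mono[OF pos n y(4) _ trunc_zero(2)[OF n elim(2)]] elim(1)
        trunc_zero(3)[OF n elim(2)] by fastforce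
    then show ?case
      using y by simp
  qed
qed

text \<open>Truncation at \<open>M + 1\<close> leaves \<open>M + 1\<close> poles but only
  \<open>M\<close> interlacing zeros. Pairing the \<open>n\<close>-th zero with the
  \<open>n\<close>-th pole leaves the last pole over, whence the factor
  \<open>1 - z / (M + 1)\<close>; the value at \<open>0\<close> is the partial mass, by which one
  divides.\<close>

lemma trunc_product:
  fixes z :: "'a::{real_normed_field, banach}"
  assumes z: "z \<notin> of_nat ` {1..}"
  shows "(\<Prod>n<M. (1 - z / of_real (trunc_zero (Suc M) (Suc n))) / (1 - z / of_nat (Suc n)))
    = stieltjes (trunc (Suc M)) z * (1 - z / of_nat (Suc M)) / of_real (\<Sum>k=1..Suc M. w k)"
proof -
  let ?r = "\<lambda>n. trunc_zero (Suc M) n"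
  let ?K = "of_nat ` {1..Suc M} :: 'a set" and ?R = "(\<lambda>n. of_real (?r n)) ` {1..M} :: 'a set"
  \<comment> \<open>The partial fraction identity is indexed by the poles themselves, so a weight
    has to be recovered from its pole by inverting \<open>of_nat\<close>.\<close>
  define c :: "'a \<Rightarrow> 'a" where "c y = of_real (w (the_inv of_nat y))" for y
  have c: "c (of_nat k) = of_real (w k)" for k
    unfolding c_def by (simp add: the_inv_f_f inj_of_nat)
  have injK: "inj_on (of_nat :: nat \<Rightarrow> 'a) A" for A
    by (rule inj_on_subset[OF inj_of_nat]) simp
  have r: "real n < ?r n" "?r n < real n + 1" "stieltjes (trunc (Suc M)) (?r n) = 0" if "n \<in> {1..M}" for n
    using trunc_zero[of n "Suc M"] that by auto
  have injR: "inj_on (\<lambda>n. of_real (?r n) :: 'a) {1..M}"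
  proof (rule linorder_inj_onI)
    fix m n assume mn: "m < n" "m \<in> {1..M}" "n \<in> {1..M}"
    then have "real m + 1 \<le> real n"
      by linarith
    then show "of_real (?r m) \<noteq> (of_real (?r n) :: 'a)"
      using r(2)[OF mn(2)] r(1)[OF mn(3)] by simp
  qed auto
  have r_nat: "?r n \<notin> of_nat ` {1..}" if "n \<in> {1..M}" for n
    using not_nat_between r[OF that] by blast
  have "(\<Sum>k\<in>?K. c k * (k / (k - z))) * (\<Prod>k\<in>?K. 1 - z / k) = (\<Sum>k\<in>?K. c k) * (\<Prod>r\<in>?R. 1 - z / r)"
  proof (rule partial_fraction_product)
    show "card ?R + 1 = card ?K"
      by (simp only: card_image[OF injK] card_image[OF injR] card_atLeastAtMost)
    show "0 \<notin> ?R"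
      using r(1) by fastforce
    show "?K \<inter> ?R = {}"
    proof (rule ccontr)
      assume "?K \<inter> ?R \<noteq> {}"
      then obtain k n where k: "k \<in> {1..Suc M}" and n: "n \<in> {1..M}"
        and "of_nat k = (of_real (?r n) :: 'a)"
        by blast
      then have "of_real (real k) = (of_real (?r n) :: 'a)"
        by simp
      then have "?r n = real k"
        unfolding of_real_eq_iff by simp
      then show False
        using r_nat[OF n] k by auto
    qed
    show "(\<Sum>k\<in>?K. c k * (k / (k - r))) = 0" if "r \<in> ?R" for r
    proof -
      from that obtain n where n: "n \<in> {1..M}" and "r = of_real (?r n)"
        by blast
      then have "(\<Sum>k\<in>?K. c k * (k / (k - r))) = stieltjes (trunc (Suc M)) (of_real (?r n))"
        by (simp only: sum.reindex[OF injK] stieltjes_trunc o_def c)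
      also have "\<dots> = 0"
        unfolding weights.stieltjes_of_real[OF weights_trunc r_nat[OF n]] r(3)[OF n] by simp
      finally show ?thesis .
    qed
    show "z \<notin> ?K"
      using z by auto
  qed auto
  then have main: "stieltjes (trunc (Suc M)) z * (\<Prod>k=1..Suc M. 1 - z / of_nat k)
      = of_real (\<Sum>k=1..Suc M. w k) * (\<Prod>n=1..M. 1 - z / of_real (?r n))"
    by (simp only: sum.reindex[OF injK] prod.reindex[OF injK] prod.reindex[OF injR]
        stieltjes_trunc o_def c of_real_sum)
  have W: "(\<Sum>k=1..Suc M. w k) > 0"
    using w_pos by (intro sum_pos) auto
  have nz: "1 - z / of_nat k \<noteq> 0" if "k \<ge> 1" for k
    using z that by (auto simp: field_simps)
  then have P: "(\<Prod>k=1..M. 1 - z / of_nat k) \<noteq> 0"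
    by simp
  have "(\<Prod>n<M. (1 - z / of_real (?r (Suc n))) / (1 - z / of_nat (Suc n)))
      = (\<Prod>n=1..M. (1 - z / of_real (?r n)) / (1 - z / of_nat n))"
    by (rule prod.reindex_bij_witness[of _ "\<lambda>n. n - 1" Suc]) auto
  also have "\<dots> = (\<Prod>n=1..M. 1 - z / of_real (?r n)) / (\<Prod>k=1..M. 1 - z / of_nat k)"
    by (rule prod_dividef)
  also have "\<dots> = stieltjes (trunc (Suc M)) z * (1 - z / of_nat (Suc M)) / of_real (\<Sum>k=1..Suc M. w k)"
  proof -
    have "(of_real (\<Sum>k=1..Suc M. w k) :: 'a) \<noteq> 0"
      using W by (simp only: of_real_eq_0_iff)
    moreover have "(\<Prod>k=1..Suc M. 1 - z / of_nat k) = (\<Prod>k=1..M. 1 - z / of_nat k) * (1 - z / of_nat (Suc M))"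
      by simp
    moreover have "A / P = S * q / V" if "V \<noteq> 0" "S * (P * q) = V * A" "P \<noteq> 0" for A P S q V :: 'a
      using that by (simp add: field_simps)
    ultimately show ?thesis
      using main P by metis
  qed
  finally show ?thesis .
qed

text \<open>In \<open>trunc_product\<close> the leftover factor and the partial mass both tend to
  one, so the truncated products tend to the transform; by \<open>tannery_prod\<close> the products
  over the limiting zeros have the same limit.\<close>

lemma stieltjes_product_tendsto:
  fixes z :: "'a::{real_normed_field, banach}"
  assumes z: "z \<notin> of_nat ` {1..}"
  shows "(\<lambda>N. \<Prod>k<N. (1 - z / of_real (zero (Suc k))) / (1 - z / of_nat (Suc k))) \<longlonglongrightarrow> stieltjes w z"
proof -
  obtain d C where d: "d > 0" "cball z d \<inter> of_nat ` {1..} = {}"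
    and "\<And>n y. y \<in> cball z d \<Longrightarrow> norm (of_nat n / (of_nat n - y)) \<le> C"
    using kernel_bound[OF z] by blast
  then have C: "norm (of_nat n / (of_nat n - z)) \<le> C" for n
    by (metis centre_in_cball less_imp_le)
  have diff: "(\<lambda>N. (\<Prod>k<N. (1 - z / of_real (trunc_zero (Suc N) (Suc k))) / (1 - z / of_nat (Suc k)))
      - (\<Prod>k<N. (1 - z / of_real (zero (Suc k))) / (1 - z / of_nat (Suc k)))) \<longlonglongrightarrow> 0"
  proof (rule tannery_prod)
    fix k
    have nz: "1 - z / of_nat (Suc k) \<noteq> 0"
      using z by (auto simp: field_simps simp del: of_nat_Suc)
    have r: "(of_real (zero (Suc k)) :: 'a) \<noteq> 0"
      using zero[of "Suc k"] by simp
    have "(\<lambda>N. trunc_zero (Suc N) (Suc k)) \<longlonglongrightarrow> zero (Suc k)"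
      using trunc_zero_tendsto[of "Suc k"] by (intro LIMSEQ_Suc) simp
    then show "(\<lambda>N. (1 - z / of_real (trunc_zero (Suc N) (Suc k))) / (1 - z / of_nat (Suc k)))
        \<longlonglongrightarrow> (1 - z / of_real (zero (Suc k))) / (1 - z / of_nat (Suc k))"
      by (intro tendsto_intros nz r)
    show "norm ((1 - z / of_real (zero (Suc k))) / (1 - z / of_nat (Suc k)) - 1)
        \<le> norm z * C * (1 / real (Suc k) - 1 / real (Suc (Suc k)))"
      using zero[of "Suc k"] by (intro factor_bound z C) auto
    show "norm ((1 - z / of_real (trunc_zero (Suc N) (Suc k))) / (1 - z / of_nat (Suc k)) - 1)
        \<le> norm z * C * (1 / real (Suc k) - 1 / real (Suc (Suc k)))" if "k < N" for N
      using trunc_zero[of "Suc k" "Suc N"] that by (intro factor_bound z C) auto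
  qed (rule summable_factor_bound)
  have "(\<lambda>m. \<Sum>k\<le>m. w k) \<longlonglongrightarrow> 1"
    using w_sums by (simp add: sums_def_le)
  moreover have "(\<Sum>k\<le>m. w k) = (\<Sum>k=1..m. w k)" for m
    unfolding atMost_atLeast0 by (subst sum.atLeast_Suc_atMost) (auto simp: w_0)
  ultimately have W: "(\<lambda>N. \<Sum>k=1..Suc N. w k) \<longlonglongrightarrow> 1"
    by (intro LIMSEQ_Suc[of "\<lambda>m. \<Sum>k=1..m. w k"]) simp
  have inv: "(\<lambda>N. 1 / of_nat (Suc N) :: 'a) \<longlonglongrightarrow> 0"
    by (rule lim_1_over_n[THEN LIMSEQ_Suc])
  have "(\<lambda>N. stieltjes (trunc (Suc N)) z * (1 - z * (1 / of_nat (Suc N))) / of_real (\<Sum>k=1..Suc N. w k))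
      \<longlonglongrightarrow> stieltjes w z * (1 - z * 0) / of_real 1"
    by (intro tendsto_intros W inv stieltjes_trunc_tendsto[OF z, THEN LIMSEQ_Suc]) simp
  then have "(\<lambda>N. \<Prod>k<N. (1 - z / of_real (trunc_zero (Suc N) (Suc k))) / (1 - z / of_nat (Suc k)))
      \<longlonglongrightarrow> stieltjes w z"
    unfolding trunc_product[OF z] by simp
  from tendsto_diff[OF this diff] show ?thesis
    by simp
qed

text \<open>\<open>has_prod\<close> says more than convergence of the partial products, which could
  also diverge to zero. Summability of the factors minus one provides the convergence, and the limit
  already computed identifies the value.\<close>

theorem stieltjes_has_prod:
  fixes z :: "'a::{real_normed_field, banach}"
  assumes z: "z \<notin> of_nat ` {1..}"
  shows "(\<lambda>k. (1 - z / of_real (zero (Suc k))) / (1 - z / of_nat (Suc k))) has_prod stieltjes w z"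
proof -
  let ?g = "\<lambda>k. (1 - z / of_real (zero (Suc k))) / (1 - z / of_nat (Suc k))"
  obtain d C where d: "d > 0" "cball z d \<inter> of_nat ` {1..} = {}"
    and "\<And>n y. y \<in> cball z d \<Longrightarrow> norm (of_nat n / (of_nat n - y)) \<le> C"
    using kernel_bound[OF z] by blast
  then have C: "norm (of_nat n / (of_nat n - z)) \<le> C" for n
    by (metis centre_in_cball less_imp_le)
  have "summable (\<lambda>k. norm (?g k - 1))"
  proof (rule summable_comparison_test'[OF summable_factor_bound[of "norm z * C"], of 0])
    show "norm (norm (?g k - 1)) \<le> norm z * C * (1 / real (Suc k) - 1 / real (Suc (Suc k)))" for k
      unfolding real_norm_def abs_norm_cancel using zero[of "Suc k"] by (intro factor_bound z C) auto
  qed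
  then have "convergent_prod ?g"
    by (intro abs_convergent_prod_imp_convergent_prod summable_imp_abs_convergent_prod)
  then have g: "?g has_prod prodinf ?g"
    by (rule convergent_prod_has_prod)
  then show ?thesis
    using LIMSEQ_unique[OF has_prod_imp_tendsto'[OF g] stieltjes_product_tendsto[OF z]] by simp
qed

text \<open>The factors minus one have a summable majorant on the ball, so the products converge
  uniformly to some function; the pointwise limit identifies it. Compactness of closed balls comes
  from \<open>heine_borel\<close>.\<close>

theorem stieltjes_product_uniform:
  fixes z :: "'a::{real_normed_field, banach, heine_borel}"
  assumes z: "z \<notin> of_nat ` {1..}"
  obtains d where "d > 0" "cball z d \<inter> of_nat ` {1..} = {}"
    "uniform_limit (cball z d)
      (\<lambda>N y. \<Prod>n=1..N. (1 - y / of_real (zero n)) / (1 - y / of_nat n)) (stieltjes w) sequentially"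
proof -
  let ?g = "\<lambda>k y. (1 - y / of_real (zero (Suc k))) / (1 - y / of_nat (Suc k)) :: 'a"
  obtain d C where d: "d > 0" and disj: "cball z d \<inter> of_nat ` {1..} = {}"
    and C: "\<And>n y. y \<in> cball z d \<Longrightarrow> norm (of_nat n / (of_nat n - y)) \<le> C"
    using kernel_bound[OF z] by blast
  have C0: "C \<ge> 0"
    using C[of z 0] d by simp
  have off: "y \<notin> of_nat ` {1..}" if "y \<in> cball z d" for y
    using disj that by blast
  have unif: "uniformly_convergent_on (cball z d) (\<lambda>N y. \<Prod>k<N. ?g k y)"
  proof (rule uniformly_convergent_on_prod')
    show "continuous_on (cball z d) (?g k)" for k
    proof (intro continuous_intros ballI)
      fix y assume "y \<in> cball z d"
      then have "y \<notin> of_nat ` {1..}"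
        by (rule off)
      moreover have "(of_nat (Suc k) :: 'a) \<in> of_nat ` {1..}"
        by (intro imageI) simp
      ultimately have "y \<noteq> of_nat (Suc k)"
        by metis
      then show "1 - y / of_nat (Suc k) \<noteq> 0"
        by (auto simp: field_simps simp del: of_nat_Suc)
    qed (use zero[of "Suc k"] in \<open>auto simp del: of_nat_Suc\<close>)
    show "uniformly_convergent_on (cball z d) (\<lambda>N y. \<Sum>k<N. norm (?g k y - 1))"
    proof (rule Weierstrass_m_test'[OF _ summable_factor_bound])
      fix k y assume y: "y \<in> cball z d"
      have "norm (?g k y - 1) \<le> norm y * C * (1 / real (Suc k) - 1 / real (Suc (Suc k)))"
        using zero[of "Suc k"] by (intro factor_bound off y C) auto
      also have "\<dots> \<le> (norm z + d) * C * (1 / real (Suc k) - 1 / real (Suc (Suc k)))"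
      proof (intro mult_right_mono C0)
        show "norm y \<le> norm z + d"
          using y norm_triangle_ineq[of z "y - z"] by (simp add: dist_norm norm_minus_commute)
      qed (auto intro!: divide_left_mono)
      finally show "norm (norm (?g k y - 1)) \<le> (norm z + d) * C * (1 / real (Suc k) - 1 / real (Suc (Suc k)))"
        by (simp only: real_norm_def abs_norm_cancel)
    qed
  qed (rule compact_cball)
  then obtain l where l: "uniform_limit (cball z d) (\<lambda>N y. \<Prod>k<N. ?g k y) l sequentially"
    unfolding uniformly_convergent_on_def by blast
  have l_eq: "l y = stieltjes w y" if "y \<in> cball z d" for y
    using LIMSEQ_unique[OF tendsto_uniform_limitI[OF l that] stieltjes_product_tendsto[OF off[OF that]]] .
  have "(\<Prod>k<N. ?g k y) = (\<Prod>n=1..N. (1 - y / of_real (zero n)) / (1 - y / of_nat n))" for N y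
    by (rule prod.reindex_bij_witness[of _ "\<lambda>n. n - 1" Suc]) auto
  then have "uniform_limit (cball z d)
      (\<lambda>N y. \<Prod>n=1..N. (1 - y / of_real (zero n)) / (1 - y / of_nat n)) (stieltjes w) sequentially"
    by (intro uniform_limit_cong'[THEN iffD1, OF _ _ l] l_eq)
  with d disj show ?thesis
    by (rule that)
qed

end

section \<open>Binomial weights and Gregory coefficients\<close>

text \<open>The coefficients of \<open>1 - (1 - t) powr x\<close> in powers of \<open>t\<close>;
  with this sign they are nonnegative for \<open>x\<close> between 0 and 1.\<close>

definition binom_weight :: "real \<Rightarrow> nat \<Rightarrow> real" where
  "binom_weight x n = (if n = 0 then 0 else - ((- 1) ^ n * (x gchoose n)))"

lemma binom_weight_Suc:
  assumes "n \<ge> 1"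
  shows "binom_weight x (Suc n) = binom_weight x n * ((real n - x) / real (Suc n))"
proof -
  have "real (Suc n) * (x gchoose Suc n) = (x - real n) * (x gchoose n)"
    using gbinomial_mult_1[of x n] by (simp add: algebra_simps)
  then have "x gchoose Suc n = - ((x gchoose n) * ((real n - x) / real (Suc n)))"
    by (simp add: field_simps del: of_nat_Suc)
  then show ?thesis
    using assms by (simp add: binom_weight_def del: of_nat_Suc)
qed

lemma binom_weight_nonneg:
  assumes "0 \<le> x" "x \<le> 1"
  shows "binom_weight x n \<ge> 0"
proof (cases "n = 0")
  case False
  then have "n \<ge> 1"
    by simp
  then show ?thesis
  proof (induction n rule: dec_induct)
    case base
    then show ?case
      using assms by (simp add: binom_weight_def)
  next
    case (step n)
    then show ?case
      unfolding binom_weight_Suc[OF step(1)] using assms by (intro mult_nonneg_nonneg divide_nonneg_nonneg) auto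
  qed
qed (simp add: binom_weight_def)

lemma binom_weight_pos:
  assumes "0 < x" "x < 1" and "n \<ge> 1"
  shows "binom_weight x n > 0"
  using assms(3)
proof (induction n rule: dec_induct)
  case base
  then show ?case
    using assms by (simp add: binom_weight_def)
next
  case (step n)
  then show ?case
    unfolding binom_weight_Suc[OF step(1)] using assms by (intro mult_pos_pos divide_pos_pos) auto
qed

lemma continuous_on_gbinomial: "continuous_on A (\<lambda>x::real. x gchoose n)"
  unfolding gbinomial_prod_rev by (intro continuous_intros) auto

lemma continuous_on_binom_weight: "continuous_on A (\<lambda>x. binom_weight x n)"
  by (cases "n = 0") (auto simp: binom_weight_def intro!: continuous_intros continuous_on_gbinomial)

lemma binom_weight_powser:
  assumes "0 \<le> t" "t < 1"
  shows "(\<lambda>n. binom_weight x n * t ^ n) sums (1 - (1 - t) powr x)"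
proof -
  have "(\<lambda>n. (x gchoose n) * (- t) ^ n) sums (1 - t) powr x"
    using gen_binomial_real[of "- t" x] assms by simp
  then have "(\<lambda>n. (if n = 0 then 1 else 0) - (x gchoose n) * (- t) ^ n) sums (1 - (1 - t) powr x)"
    by (intro sums_diff sums_single)
  moreover have "(if n = 0 then 1 else 0) - (x gchoose n) * (- t) ^ n = binom_weight x n * t ^ n" for n
    by (simp add: binom_weight_def power_minus[of t] mult_ac)
  ultimately show ?thesis
    by simp
qed

text \<open>For \<open>t < 1\<close> the partial sums of the power series stay below
  \<open>1 - (1 - t) powr x\<close>, hence below one; let \<open>t\<close> tend to 1.\<close>

lemma binom_weight_partial_le:
  assumes x: "0 \<le> x" "x \<le> 1"
  shows "(\<Sum>n<m. binom_weight x n) \<le> 1"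
proof (rule tendsto_upperbound)
  have "((\<lambda>t. \<Sum>n<m. binom_weight x n * t ^ n) \<longlongrightarrow> (\<Sum>n<m. binom_weight x n * 1 ^ n)) (at_left 1)"
    by (intro tendsto_intros)
  then show "((\<lambda>t. \<Sum>n<m. binom_weight x n * t ^ n) \<longlongrightarrow> (\<Sum>n<m. binom_weight x n)) (at_left 1)"
    by simp
  have "\<forall>\<^sub>F t in at_left (1::real). 0 < t \<and> t < 1"
    using eventually_at_left_real[of 0 1] by (auto elim: eventually_mono)
  then show "\<forall>\<^sub>F t in at_left 1. (\<Sum>n<m. binom_weight x n * t ^ n) \<le> 1"
  proof eventually_elim
    case (elim t)
    note s = binom_weight_powser[of t x]
    have "(\<Sum>n<m. binom_weight x n * t ^ n) \<le> (\<Sum>n. binom_weight x n * t ^ n)"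
      using s elim binom_weight_nonneg[OF x] by (intro sum_le_suminf) (auto simp: sums_iff)
    also have "\<dots> \<le> 1"
      using s elim by (simp add: sums_iff)
    finally show ?case .
  qed
qed simp

lemma weights_binom_weight:
  assumes x: "0 \<le> x" "x \<le> 1"
  shows "weights (binom_weight x)"
proof
  show nonneg: "binom_weight x n \<ge> 0" for n
    by (rule binom_weight_nonneg[OF x])
  show "summable (binom_weight x)"
    using binom_weight_partial_le[OF x] nonneg by (intro summableI_nonneg_bounded[where x = 1]) auto
qed

text \<open>The missing lower bound is an Abel argument: the total dominates
  \<open>1 - (1 - t) powr x\<close>, which tends to one as \<open>t\<close> tends to 1. At
  \<open>x = 0\<close> all weights vanish, hence the strict inequality.\<close>

lemma binom_weight_sums:
  assumes x: "0 < x" "x \<le> 1"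
  shows "binom_weight x sums 1"
proof -
  interpret weights "binom_weight x"
    using x by (intro weights_binom_weight) auto
  have "suminf (binom_weight x) \<le> 1"
    using binom_weight_partial_le[of x] x by (intro suminf_le_const summable_w) auto
  moreover have "1 \<le> suminf (binom_weight x)"
  proof (rule tendsto_upperbound)
    have "((\<lambda>t::real. 1 - (1 - t) powr x) \<longlongrightarrow> 1 - (1 - 1) powr x) (at_left 1)"
      using x by (intro tendsto_intros tendsto_powr') (auto simp: eventually_at_filter)
    then show "((\<lambda>t. 1 - (1 - t) powr x) \<longlongrightarrow> 1) (at_left 1)"
      by simp
    have "\<forall>\<^sub>F t in at_left (1::real). 0 < t \<and> t < 1"
      using eventually_at_left_real[of 0 1] by (auto elim: eventually_mono)
    then show "\<forall>\<^sub>F t in at_left 1. 1 - (1 - t) powr x \<le> suminf (binom_weight x)"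
    proof eventually_elim
      case (elim t)
      have le: "binom_weight x n * t ^ n \<le> binom_weight x n" for n
        using elim nonneg[of n] power_le_one[of t n] mult_left_mono[of "t ^ n" 1 "binom_weight x n"] by simp
      show ?case
        using elim by (intro sums_le[OF le binom_weight_powser summable_sums[OF summable_w]]) auto
    qed
  qed simp
  ultimately show ?thesis
    using summable_sums[OF summable_w] by simp
qed

text \<open>As \<open>1 / (n + s)\<close> is the integral of \<open>t powr (s - 1) * t ^ n\<close>,
  the series of \<open>binom_weight x n / (n + s)\<close> sums to
  \<open>1 / s - Beta s (x + 1)\<close>. Then \<open>n / (n + s) = 1 - s / (n + s)\<close> and total
  mass one leave \<open>s * Beta s (x + 1)\<close>.\<close>

lemma stieltjes_binom_weight_neg:
  assumes x: "0 < x" "x \<le> 1" and s: "s > 1"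
  shows "stieltjes (binom_weight x) (- s) = Gamma (1 + s) * Gamma (1 + x) / Gamma (1 + x + s)"
proof -
  interpret weights "binom_weight x"
    using x by (intro weights_binom_weight) auto
  let ?\<beta> = "binom_weight x"
  have mono: "((\<lambda>t. t powr (s - 1) * t ^ n) has_integral 1 / (real n + s)) {0..1}" for n
  proof (rule has_integral_eq[rotated])
    show "((\<lambda>t. t powr (s - 1 + real n)) has_integral 1 / (real n + s)) {0..1}"
      using has_integral_powr_from_0[of "s - 1 + real n" 1] s by (simp add: add_ac)
    show "t powr (s - 1 + real n) = t powr (s - 1) * t ^ n" if "t \<in> {0..1}" for t
      using that s by (cases "t = 0") (auto simp: powr_add powr_realpow)
  qed
  \<comment> \<open>Integrating one minus the partial sum keeps the integrand between 0 and
    \<open>t powr (s - 1)\<close>, and its limit is directly the Beta integrand.\<close>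
  have sum: "((\<lambda>t. t powr (s - 1) * (1 - (\<Sum>n<m. ?\<beta> n * t ^ n))) has_integral
      1 / s - (\<Sum>n<m. ?\<beta> n * (1 / (real n + s)))) {0..1}" for m
  proof -
    have "((\<lambda>t. t powr (s - 1) * t ^ 0 - (\<Sum>n<m. ?\<beta> n * (t powr (s - 1) * t ^ n))) has_integral
        1 / (real 0 + s) - (\<Sum>n<m. ?\<beta> n * (1 / (real n + s)))) {0..1}"
      by (intro has_integral_diff has_integral_sum has_integral_mult_right mono) auto
    then show ?thesis
      by (simp add: right_diff_distrib sum_distrib_left mult_ac)
  qed
  have "((\<lambda>t. t powr (s - 1) * (1 - t) powr x) has_integral Beta s (x + 1)) {0..1}"
    using has_integral_Beta_real[of s "x + 1"] x s by simp
  moreover have "(\<lambda>m. integral {0..1} (\<lambda>t. t powr (s - 1) * (1 - (\<Sum>n<m. ?\<beta> n * t ^ n))))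
      \<longlonglongrightarrow> integral {0..1} (\<lambda>t. t powr (s - 1) * (1 - t) powr x)"
  proof (rule dominated_convergence(2))
    show "(\<lambda>t. t powr (s - 1) * (1 - (\<Sum>n<m. ?\<beta> n * t ^ n))) integrable_on {0..1}" for m
      using sum by blast
    show "(\<lambda>t. t powr (s - 1)) integrable_on {0..1}"
      using mono[of 0] by auto
    fix t :: real assume t: "t \<in> {0..1}"
    show "norm (t powr (s - 1) * (1 - (\<Sum>n<m. ?\<beta> n * t ^ n))) \<le> t powr (s - 1)" for m
    proof -
      have "(\<Sum>n<m. ?\<beta> n * t ^ n) \<le> (\<Sum>n<m. ?\<beta> n * 1)"
        using t nonneg by (intro sum_mono mult_left_mono power_le_one) auto
      also have "\<dots> \<le> 1"
        using binom_weight_partial_le[of x m] x by simp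
      finally have "(\<Sum>n<m. ?\<beta> n * t ^ n) \<le> 1" .
      moreover have "0 \<le> (\<Sum>n<m. ?\<beta> n * t ^ n)"
        using t nonneg by (intro sum_nonneg) auto
      ultimately show ?thesis
        by (simp add: abs_mult mult_left_le)
    qed
    \<comment> \<open>At the endpoint \<open>t = 1\<close> the power series is the total mass, and
      \<open>0 powr x = 0\<close> makes the formula fit.\<close>
    have "(\<lambda>n. ?\<beta> n * t ^ n) sums (1 - (1 - t) powr x)"
      using t x binom_weight_powser[of t x] binom_weight_sums[OF x] by (cases "t = 1") auto
    then have "(\<lambda>m. t powr (s - 1) * (1 - (\<Sum>n<m. ?\<beta> n * t ^ n)))
        \<longlonglongrightarrow> t powr (s - 1) * (1 - (1 - (1 - t) powr x))"
      unfolding sums_def by (intro tendsto_intros)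
    then show "(\<lambda>m. t powr (s - 1) * (1 - (\<Sum>n<m. ?\<beta> n * t ^ n)))
        \<longlonglongrightarrow> t powr (s - 1) * (1 - t) powr x"
      by simp
  qed
  ultimately have "(\<lambda>m. 1 / s - (\<Sum>n<m. ?\<beta> n * (1 / (real n + s)))) \<longlonglongrightarrow> Beta s (x + 1)"
    by (simp add: integral_unique[OF sum] integral_unique)
  then have "(\<lambda>m. 1 / s - (1 / s - (\<Sum>n<m. ?\<beta> n * (1 / (real n + s))))) \<longlonglongrightarrow> 1 / s - Beta s (x + 1)"
    by (intro tendsto_intros)
  then have "(\<lambda>n. ?\<beta> n * (1 / (real n + s))) sums (1 / s - Beta s (x + 1))"
    by (simp add: sums_def)
  then have "(\<lambda>n. ?\<beta> n - s * (?\<beta> n * (1 / (real n + s)))) sums (1 - s * (1 / s - Beta s (x + 1)))"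
    by (intro sums_diff sums_mult binom_weight_sums[OF x])
  moreover have "?\<beta> n - s * (?\<beta> n * (1 / (real n + s))) = ?\<beta> n * (real n / (real n - (- s)))" for n
  proof -
    have "real n + s \<noteq> 0"
      using s by (simp add: add_nonneg_eq_0_iff)
    then show ?thesis
      by (simp add: field_simps)
  qed
  ultimately have "stieltjes ?\<beta> (- s) = 1 - s * (1 / s - Beta s (x + 1))"
    unfolding stieltjes_def by (simp add: sums_iff)
  also have "\<dots> = s * Beta s (x + 1)"
    using s by (simp add: algebra_simps)
  also have "\<dots> = (s * Gamma s) * Gamma (x + 1) / Gamma (s + (x + 1))"
    by (simp add: Beta_def)
  also have "s * Gamma s = Gamma (1 + s)"
  proof -
    have "s \<notin> \<int>\<^sub>\<le>\<^sub>0"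
      using s by (auto elim!: nonpos_Ints_cases)
    then show ?thesis
      using Gamma_plus1[of s] by (simp add: add.commute)
  qed
  finally show ?thesis
    by (simp add: add_ac)
qed

lemma connected_Compl_of_nat: "connected (- of_nat ` A :: complex set)"
  unfolding Compl_eq_Diff_UNIV
  by (rule connected_open_diff_countable) (auto intro: countable_subset[OF _ countable_image])

text \<open>Off the positive integers both sides are holomorphic: these are exactly the poles of
  \<open>Gamma (1 - z)\<close>, and \<open>rGamma\<close> is entire. They agree on the real ray
  below \<open>-1\<close>, and the domain is connected.\<close>

lemma stieltjes_binom_weight:
  fixes z :: complex
  assumes x: "0 < x" "x \<le> 1" and z: "z \<notin> of_nat ` {1..}"
  shows "stieltjes (binom_weight x) z = Gamma (1 - z) * Gamma (of_real (1 + x)) * rGamma (of_real (1 + x) - z)"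
proof -
  interpret weights "binom_weight x"
    using x by (intro weights_binom_weight) auto
  let ?S = "- of_nat ` {1..} :: complex set"
  let ?f = "\<lambda>z. stieltjes (binom_weight x) z
    - Gamma (1 - z) * Gamma (of_real (1 + x)) * rGamma (of_real (1 + x) - z)"
  let ?U = "of_real ` {..<-1} :: complex set"
  have U: "complex_of_real s \<notin> of_nat ` {1..}" if "s < -1" for s
  proof
    assume "complex_of_real s \<in> of_nat ` {1..}"
    then obtain n where "complex_of_real s = of_real (real n)"
      by auto
    then show False
      using that unfolding of_real_eq_iff by simp
  qed
  have "?f z = 0"
  proof (rule analytic_continuation[where f = ?f])
    have "1 - y \<notin> \<int>\<^sub>\<le>\<^sub>0" if "y \<in> ?S" for y :: complex
    proof
      assume "1 - y \<in> \<int>\<^sub>\<le>\<^sub>0"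
      then obtain n where "1 - y = - of_nat n"
        by (rule nonpos_Ints_cases')
      then have "y = of_nat (Suc n)"
        by (simp add: algebra_simps)
      then have "y \<in> of_nat ` {1..}"
        by (intro image_eqI[of _ _ "Suc n"]) auto
      then show False
        using that by simp
    qed
    then show "?f holomorphic_on ?S"
      by (intro holomorphic_intros holomorphic_stieltjes) auto
    show "open ?S"
      by (rule open_Compl[OF closed_of_nat_image])
    show "connected ?S"
      by (rule connected_Compl_of_nat)
    show "?U \<subseteq> ?S"
      by (intro subsetI, elim imageE) (simp only: Compl_iff U lessThan_iff, simp)
    \<comment> \<open>A connected set with more than one point has no isolated points.\<close>
    show "complex_of_real (- 2) islimpt ?U"
    proof (rule connected_imp_perfect)
      show "connected ?U"
        by (intro connected_continuous_image continuous_intros) auto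
      show "?U \<noteq> {y}" for y
      proof
        assume "?U = {y}"
        moreover have "complex_of_real (- 2) \<in> ?U" "complex_of_real (- 3) \<in> ?U"
          by (rule imageI, simp)+
        ultimately have "complex_of_real (- 2) = complex_of_real (- 3)"
          by (metis singletonD)
        then show False
          unfolding of_real_eq_iff by simp
      qed
    qed (rule imageI, simp)
    show "complex_of_real (- 2) \<in> ?S"
      using U[of "- 2"] by simp
    fix y assume "y \<in> ?U"
    then obtain s where s: "y = of_real (- s)" "s > 1"
      by (metis imageE lessThan_iff minus_minus neg_less_iff_less)
    have "stieltjes (binom_weight x) y = of_real (stieltjes (binom_weight x) (- s))"
      unfolding s(1)
    proof (rule stieltjes_of_real)
      show "- s \<notin> real ` {1..}"
        using s by auto
    qed
    also have "\<dots> = of_real (Gamma (1 + s) * Gamma (1 + x) / Gamma (1 + x + s))"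
      unfolding stieltjes_binom_weight_neg[OF x s(2)] ..
    also have "\<dots> = Gamma (1 - y) * Gamma (of_real (1 + x)) * rGamma (of_real (1 + x) - y)"
      unfolding s(1) by (simp add: rGamma_inverse_Gamma divide_inverse flip: Gamma_complex_of_real)
    finally show "?f y = 0"
      by simp
  qed (use z in auto)
  then show ?thesis
    by simp
qed

section \<open>Gregory coefficients as integrals of binomial coefficients\<close>

lemma norm_gbinomial_le_1:
  fixes x :: real
  assumes "0 \<le> x" "x \<le> 1"
  shows "\<bar>x gchoose n\<bar> \<le> 1"
proof (cases "n = 0")
  case False
  then have "\<bar>x gchoose n\<bar> = binom_weight x n"
    using abs_of_nonneg[OF binom_weight_nonneg[OF assms, of n]]
    by (simp add: binom_weight_def abs_mult power_abs)
  also have "\<dots> \<le> (\<Sum>k<Suc n. binom_weight x k)"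
    using binom_weight_nonneg[OF assms] by (intro member_le_sum) auto
  also have "\<dots> \<le> 1"
    by (rule binom_weight_partial_le[OF assms])
  finally show ?thesis .
qed simp

text \<open>The centre is left out of the hypotheses because \<open>z / Ln (1 + z)\<close> has no
  meaningful value there. The constant coefficients are compared through the limit at 0; after that,
  isolation of zeros of a nonzero power series applies.\<close>

lemma powser_coeffs_unique:
  fixes a b :: "nat \<Rightarrow> 'a::{real_normed_field, banach}"
  assumes r: "r > 0"
    and a: "\<And>z. 0 < norm z \<Longrightarrow> norm z < r \<Longrightarrow> (\<lambda>n. a n * z ^ n) sums f z"
    and b: "\<And>z. 0 < norm z \<Longrightarrow> norm z < r \<Longrightarrow> (\<lambda>n. b n * z ^ n) sums f z"
  shows "a = b"
proof
  fix m
  have d: "(\<lambda>n. (a n - b n) * z ^ n) sums 0" if "z \<noteq> 0" "norm z < r" for z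
    using sums_diff[OF a b, of z z] that by (simp add: left_diff_distrib)
  have d0: "a 0 - b 0 = 0"
    using powser_limit_0_strong[of r "\<lambda>n. a n - b n" "\<lambda>_. 0"] r d
    by (intro tendsto_unique[of "at 0" "\<lambda>_. 0"]) auto
  have dz: "(\<lambda>n. (a n - b n) * (z - 0) ^ n) sums 0" if "norm (z - 0) < r" for z
  proof (cases "z = 0")
    case True
    have "(\<lambda>n. (a n - b n) * 0 ^ n) sums ((a 0 - b 0) * 0 ^ 0)"
      by (rule sums_If_finite_set'[of "\<lambda>_. 0" 0 "{0}", THEN sums_cong[THEN iffD1, rotated]]) auto
    then show ?thesis
      using True d0 by simp
  qed (use d that in simp)
  show "a m = b m"
  proof (rule ccontr)
    assume m: "a m \<noteq> b m"
    then have "m > 0"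
      using d0 by (cases m) auto
    then obtain s where s: "s > 0" and "\<And>z::'a. z \<in> cball 0 s - {0} \<Longrightarrow> (0 :: 'a) \<noteq> 0"
      using powser_0_nonzero[of r 0 "\<lambda>n. a n - b n" "\<lambda>_. 0" m] r dz m by auto
    moreover have "of_real s \<in> cball (0 :: 'a) s - {0}"
      using s by simp
    ultimately show False
      by blast
  qed
qed

text \<open>An antiderivative in the exponent is \<open>(1 + z) powr x / Ln (1 + z)\<close>, whose
  boundary values differ by \<open>z / Ln (1 + z)\<close>. This is how the generating function of
  the Gregory coefficients arises from the binomial series.\<close>

lemma integral_powr_exponent:
  fixes z :: complex
  assumes z: "z \<noteq> 0" "1 + z \<noteq> 0"
  shows "((\<lambda>x::real. (1 + z) powr of_real x) has_integral z / Ln (1 + z)) {0..1}"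
proof -
  let ?L = "Ln (1 + z)"
  have L: "?L \<noteq> 0"
  proof
    assume "?L = 0"
    then have "exp ?L = 1"
      by simp
    then show False
      unfolding exp_Ln[OF z(2)] using z(1) by simp
  qed
  have "((\<lambda>x::real. exp (of_real x * ?L)) has_integral
      exp (of_real 1 * ?L) / ?L - exp (of_real 0 * ?L) / ?L) {0..1}"
  proof (rule fundamental_theorem_of_calculus)
    fix x :: real
    have "((\<lambda>x. exp (x * ?L) / ?L) has_field_derivative exp (of_real x * ?L)) (at (of_real x))"
      using L by (auto intro!: derivative_eq_intros)
    then show "((\<lambda>x::real. exp (of_real x * ?L) / ?L) has_vector_derivative exp (of_real x * ?L))
        (at x within {0..1})"
      by (rule has_vector_derivative_real_field)
  qed simp
  moreover have "exp (of_real 1 * ?L) / ?L - exp (of_real 0 * ?L) / ?L = z / ?L"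
    using z by (simp add: diff_divide_distrib[symmetric])
  ultimately show ?thesis
    using z by (simp add: powr_def)
qed

text \<open>Integrate the binomial series of \<open>(1 + z) powr x\<close> over \<open>x\<close>
  term by term, which the majorant \<open>cmod z ^ n\<close> allows. This yields a sequence with the
  defining property, and uniqueness of coefficients identifies it.\<close>

lemma gregory_coeff_eq: "gregory_coeff n = integral {0..1} (\<lambda>x::real. x gchoose n)"
proof -
  define g where "g n = integral {0..1} (\<lambda>x::real. x gchoose n)" for n
  have int: "((\<lambda>x. x gchoose n) has_integral g n) {0..1}" for n
    unfolding g_def by (intro integrable_integral integrable_continuous_interval continuous_on_gbinomial)
  have sums: "(\<lambda>n. of_real (g n) * z ^ n) sums (z / Ln (1 + z))"
    if z: "0 < cmod z" "cmod z < 1" for z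
  proof -
    have z0: "z \<noteq> 0" "1 + z \<noteq> 0"
      using z by (auto simp: add_eq_0_iff)
    let ?f = "\<lambda>N (x::real). \<Sum>n<N. of_real (x gchoose n) * z ^ n"
    have "uniform_limit {0..1} ?f (\<lambda>x. \<Sum>n. of_real (x gchoose n) * z ^ n) sequentially"
    proof (rule Weierstrass_m_test)
      show "norm (of_real (x gchoose n) * z ^ n) \<le> cmod z ^ n" if "x \<in> {0..1}" for n and x :: real
        using that norm_gbinomial_le_1[of x n] by (simp add: norm_mult norm_power mult_left_le_one_le)
      show "summable (\<lambda>n. cmod z ^ n)"
        using z by simp
    qed
    moreover have "(\<Sum>n. of_real (x gchoose n) * z ^ n) = (1 + z) powr of_real x" for x :: real
    proof -
      have "(of_real x gchoose n) = complex_of_real (x gchoose n)" for n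
        by (simp add: gbinomial_prod_rev)
      then show ?thesis
        using gen_binomial_complex[OF z(2), of "of_real x"] by (simp add: sums_iff)
    qed
    ultimately have lim: "uniform_limit {0..1} ?f (\<lambda>x. (1 + z) powr of_real x) sequentially"
      by simp
    have "continuous_on {0..1} (?f N)" for N
      by (intro continuous_intros continuous_on_gbinomial)
    then obtain I J where I: "\<And>N. (?f N has_integral I N) {0..1}"
      and J: "((\<lambda>x. (1 + z) powr of_real x) has_integral J) {0..1}" and IJ: "I \<longlonglongrightarrow> J"
      by (rule uniform_limit_integral[OF lim _ sequentially_bot]) (rule that; assumption)
    have "(?f N has_integral (\<Sum>n<N. of_real (g n) * z ^ n)) {0..1}" for N
      by (intro has_integral_sum has_integral_mult_left has_integral_of_real int) auto
    then have "I = (\<lambda>N. \<Sum>n<N. of_real (g n) * z ^ n)"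
      using I has_integral_unique by blast
    moreover have "J = z / Ln (1 + z)"
      using J integral_powr_exponent[OF z0] has_integral_unique by blast
    ultimately show ?thesis
      using IJ by (simp add: sums_def)
  qed
  have "gregory_coeff = g"
    unfolding gregory_coeff_def
  proof (rule the_equality)
    fix h :: "nat \<Rightarrow> real"
    assume h: "\<forall>z. 0 < cmod z \<and> cmod z < 1 \<longrightarrow> (\<lambda>n. of_real (h n) * z ^ n) sums (z / Ln (1 + z))"
    have "(\<lambda>n. complex_of_real (h n)) = (\<lambda>n. of_real (g n))"
      by (rule powser_coeffs_unique[of 1 _ "\<lambda>z. z / Ln (1 + z)"]) (use h sums in auto)
    then show "h = g"
      by (auto simp: fun_eq_iff)
  qed (use sums in blast)
  from fun_cong[OF this, of n] show ?thesis
    unfolding g_def .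
qed

text \<open>The coefficient at index 0 is 1 and is suppressed, since the basis of the Hilbert space
  starts at 1.\<close>

definition gregory_weight :: "nat \<Rightarrow> real" where
  "gregory_weight n = (if n = 0 then 0 else \<bar>gregory_coeff n\<bar>)"

text \<open>The integrand has constant sign, so its integral, a Gregory coefficient up to sign,
  equals its own absolute value.\<close>

lemma has_integral_gregory_weight: "((\<lambda>x. binom_weight x n) has_integral gregory_weight n) {0..1}"
proof (cases "n = 0")
  case False
  have int: "((\<lambda>x. binom_weight x n) has_integral - ((- 1) ^ n * gregory_coeff n)) {0..1}"
    using False unfolding binom_weight_def gregory_coeff_eq
    by (auto intro!: has_integral_neg has_integral_mult_right integrable_integral
        integrable_continuous_interval continuous_on_gbinomial)
  moreover have "0 \<le> - ((- 1) ^ n * gregory_coeff n)"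
    using int by (rule has_integral_nonneg) (auto intro: binom_weight_nonneg)
  then have "- ((- 1) ^ n * gregory_coeff n) = \<bar>gregory_coeff n\<bar>"
    by (cases "even n") auto
  ultimately show ?thesis
    using False by (simp add: gregory_weight_def)
qed (simp add: gregory_weight_def binom_weight_def)

text \<open>A continuous nonnegative function with integral zero vanishes identically, but the
  binomial weight is positive at \<open>1 / 2\<close>.\<close>

lemma gregory_weight_pos:
  assumes n: "n \<ge> 1"
  shows "gregory_weight n > 0"
proof -
  have "gregory_weight n \<ge> 0"
    by (simp add: gregory_weight_def)
  moreover have "gregory_weight n \<noteq> 0"
  proof
    assume "gregory_weight n = 0"
    then have "((\<lambda>x. binom_weight x n) has_integral 0) (cbox 0 1)"
      using has_integral_gregory_weight[of n] by simp
    then have "binom_weight (1 / 2) n = 0"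
      by (rule has_integral_0_cbox_imp_0[rotated 2])
        (auto intro: continuous_on_binom_weight binom_weight_nonneg)
    then show False
      using binom_weight_pos[of "1 / 2" n] n by simp
  qed
  ultimately show ?thesis
    by simp
qed

text \<open>Exchange of sum and integral: the binomial weights have partial sums at most one, so the
  partial sums of the series are dominated by the constant \<open>C\<close>.\<close>

lemma gregory_weight_series:
  fixes f :: "nat \<Rightarrow> complex"
  assumes f: "\<And>n. norm (f n) \<le> C"
    and g: "\<And>x. 0 < x \<Longrightarrow> x \<le> 1 \<Longrightarrow> (\<lambda>n. of_real (binom_weight x n) * f n) sums g x"
  shows "(\<lambda>n. of_real (gregory_weight n) * f n) sums integral {0..1} g"
proof -
  \<comment> \<open>At \<open>x = 0\<close> all weights vanish, so the pointwise limit there is 0;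
    changing \<open>g\<close> at one point does not affect the integral.\<close>
  define h where "h x = (if x = 0 then 0 else g x)" for x
  have int: "((\<lambda>x. \<Sum>n<m. of_real (binom_weight x n) * f n) has_integral
      (\<Sum>n<m. of_real (gregory_weight n) * f n)) {0..1}" for m
    by (intro has_integral_sum has_integral_mult_left has_integral_of_real has_integral_gregory_weight) auto
  have "(\<lambda>m. integral {0..1} (\<lambda>x. \<Sum>n<m. of_real (binom_weight x n) * f n)) \<longlonglongrightarrow> integral {0..1} h"
  proof (rule dominated_convergence(2))
    show "(\<lambda>x. \<Sum>n<m. of_real (binom_weight x n) * f n) integrable_on {0..1}" for m
      using int by blast
    show "(\<lambda>x::real. C) integrable_on {0..1}"
      by (intro integrable_continuous_interval continuous_on_const)
    fix x :: real assume x: "x \<in> {0..1}"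
    show "norm (\<Sum>n<m. of_real (binom_weight x n) * f n) \<le> C" for m
    proof -
      have C: "C \<ge> 0"
        using f[of 0] norm_ge_zero order_trans by blast
      have "norm (\<Sum>n<m. of_real (binom_weight x n) * f n) \<le> (\<Sum>n<m. binom_weight x n * C)"
      proof (rule sum_norm_le)
        fix n
        show "norm (of_real (binom_weight x n) * f n) \<le> binom_weight x n * C"
          using binom_weight_nonneg[of x n] x f by (simp add: norm_mult mult_left_mono)
      qed
      also have "\<dots> = (\<Sum>n<m. binom_weight x n) * C"
        by (simp add: sum_distrib_right)
      also have "\<dots> \<le> 1 * C"
        using C x by (intro mult_right_mono binom_weight_partial_le) auto
      finally show ?thesis
        by simp
    qed
    show "(\<lambda>m. \<Sum>n<m. of_real (binom_weight x n) * f n) \<longlonglongrightarrow> h x"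
    proof (cases "x = 0")
      case True
      then have "binom_weight x n = 0" for n
        by (simp add: binom_weight_def gbinomial_0_left)
      then show ?thesis
        using True by (simp add: h_def)
    next
      case False
      then show ?thesis
        using g[of x] x by (simp add: sums_def h_def)
    qed
  qed
  moreover have "integral {0..1} h = integral {0..1} g"
    by (rule integral_spike[of "{0}"]) (auto simp: h_def)
  ultimately show ?thesis
    by (simp add: sums_def integral_unique[OF int])
qed

lemma gregory_weight: "prob_weights gregory_weight"
proof
  show "gregory_weight 0 = 0"
    by (simp add: gregory_weight_def)
  have "(\<lambda>n. of_real (gregory_weight n) * 1) sums integral {0..1} (\<lambda>x::real. 1 :: complex)"
    using sums_of_real[OF binom_weight_sums, where 'a = complex]
    by (intro gregory_weight_series[of _ 1]) auto
  then have "(\<lambda>n. complex_of_real (gregory_weight n)) sums of_real 1"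
    by simp
  then show "gregory_weight sums 1"
    by (simp only: sums_of_real_iff)
qed (rule gregory_weight_pos)

interpretation gregory: prob_weights gregory_weight
  by (rule gregory_weight)

section \<open>The completed transform and its zeros\<close>

lemma stieltjes_gregory_weight:
  fixes z :: complex
  assumes z: "z \<notin> of_nat ` {1..}"
  shows "stieltjes gregory_weight z = Gamma (1 - z) *
    integral {0..1} (\<lambda>x::real. Gamma (of_real x + 1) * rGamma (of_real x - z + 1))"
proof -
  obtain d C where "d > 0" "cball z d \<inter> of_nat ` {1..} = {}"
    and "\<And>n y. y \<in> cball z d \<Longrightarrow> norm (of_nat n / (of_nat n - y)) \<le> C"
    using kernel_bound[OF z] by blast
  then have C: "norm (of_nat n / (of_nat n - z)) \<le> C" for n
    by (metis centre_in_cball less_imp_le)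
  have "(\<lambda>n. of_real (gregory_weight n) * (of_nat n / (of_nat n - z))) sums
      integral {0..1} (\<lambda>x::real. Gamma (1 - z) * (Gamma (of_real x + 1) * rGamma (of_real x - z + 1)))"
  proof (rule gregory_weight_series[OF C])
    fix x :: real assume x: "0 < x" "x \<le> 1"
    interpret weights "binom_weight x"
      using x by (intro weights_binom_weight) auto
    have "stieltjes (binom_weight x) z = Gamma (1 - z) * (Gamma (of_real x + 1) * rGamma (of_real x - z + 1))"
      unfolding stieltjes_binom_weight[OF x z] by (simp add: mult.assoc algebra_simps)
    then show "(\<lambda>n. of_real (binom_weight x n) * (of_nat n / (of_nat n - z))) sums
        (Gamma (1 - z) * (Gamma (of_real x + 1) * rGamma (of_real x - z + 1)))"
      using sums_stieltjes[OF z] by simp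
  qed
  then show ?thesis
    using sums_unique2[OF gregory.sums_stieltjes[OF z]] by (simp add: integral_mult_right)
qed

text \<open>Reflection turns \<open>pi / sin (pi * z)\<close> into
  \<open>Gamma z * Gamma (1 - z)\<close>, and \<open>z * rGamma (z + 1) = rGamma z\<close> cancels
  \<open>Gamma z\<close>. Integers are excluded, so no division by zero intervenes.\<close>

lemma completed_gregory_fun:
  assumes z: "z \<notin> \<int>"
  shows "of_real pi * z / sin (of_real pi * z) * gregory_fun z = stieltjes gregory_weight z"
proof -
  have "z \<notin> of_nat ` {1..}"
    using z by auto
  moreover have "of_real pi * z / sin (of_real pi * z) * rGamma (z + 1) = Gamma (1 - z)"
  proof -
    have "z \<notin> \<int>\<^sub>\<le>\<^sub>0"
      using z nonpos_Ints_subset_Ints by auto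
    then have "Gamma z * rGamma z = 1"
      by (simp add: rGamma_inverse_Gamma Gamma_eq_zero_iff)
    moreover have "of_real pi * z / sin (of_real pi * z) * rGamma (z + 1)
        = of_real pi / sin (of_real pi * z) * (z * rGamma (z + 1))"
      by simp
    ultimately show ?thesis
      unfolding rGamma_plus1 Gamma_reflection_complex[symmetric] by (simp add: mult_ac)
  qed
  ultimately show ?thesis
    by (simp add: gregory_fun_def stieltjes_gregory_weight mult.assoc[symmetric])
qed

text \<open>The quotient agrees with the transform near \<open>z\<close>, away from \<open>z\<close>
  itself, because the integers other than \<open>z\<close> form a closed set. Continuity of the
  transform then supplies the limit that \<open>remove_sings\<close> takes.\<close>

lemma gregory_transform_eq:
  assumes z: "z \<notin> of_nat ` {1..}"
  shows "gregory_transform z = stieltjes gregory_weight z"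
  unfolding gregory_transform_def
proof (rule remove_sings_eqI)
  have "closed (of_int ` (UNIV - {n. of_int n = z}) :: complex set)"
    by (rule closed_of_int_image)
  then have "open (- of_int ` (UNIV - {n. of_int n = z}) :: complex set)"
    by (rule open_Compl)
  then have "\<forall>\<^sub>F w in at z. w \<in> - of_int ` (UNIV - {n. of_int n = z}) - {z}"
    by (rule eventually_at_in_open) auto
  then have "\<forall>\<^sub>F w in at z. stieltjes gregory_weight w
      = of_real pi * w / sin (of_real pi * w) * gregory_fun w"
  proof eventually_elim
    case (elim w)
    then have "w \<notin> \<int>"
      by (auto simp: Ints_def)
    then show ?case
      by (rule completed_gregory_fun[symmetric])
  qed
  moreover have "stieltjes gregory_weight \<midarrow>z\<rightarrow> stieltjes gregory_weight z"
    using gregory.continuous_stieltjes[OF z] by (simp add: isCont_def)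
  ultimately show "(\<lambda>w. of_real pi * w / sin (of_real pi * w) * gregory_fun w)
      \<midarrow>z\<rightarrow> stieltjes gregory_weight z"
    by (rule Lim_transform_eventually[rotated])
qed

lemma gregory_zero_eq:
  assumes n: "n \<ge> 1"
  shows "gregory_zero n = gregory.zero n"
proof -
  have eq: "gregory_transform (of_real x) = 0 \<longleftrightarrow> stieltjes gregory_weight x = 0"
    if x: "real n < x" "x < real n + 1" for x
  proof -
    have off: "x \<notin> real ` {1..}"
      by (rule not_nat_between[OF x])
    have "complex_of_real x \<notin> of_nat ` {1..}"
    proof
      assume "complex_of_real x \<in> of_nat ` {1..}"
      then obtain m where m: "m \<in> {1..}" and "complex_of_real x = of_real (real m)"
        by auto
      then have "x = real m"
        unfolding of_real_eq_iff by simp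
      then show False
        using off m by blast
    qed
    then have "gregory_transform (of_real x) = of_real (stieltjes gregory_weight x)"
      using gregory.stieltjes_of_real[OF off] by (rule trans[OF gregory_transform_eq])
    then show ?thesis
      by simp
  qed
  then show ?thesis
    unfolding gregory_zero_def gregory.zero_def
    by (intro arg_cong[where f = The] ext conj_cong refl eq)
qed

section \<open>The relative determinant\<close>

lemma has_sum_product_complex:
  fixes f :: "'i \<Rightarrow> complex" and g :: "'j \<Rightarrow> complex"
  assumes f: "(f has_sum a) A" and g: "(g has_sum b) B"
  shows "((\<lambda>(x, y). f x * g y) has_sum a * b) (A \<times> B)"
proof (rule has_sum_SigmaI)
  show "((\<lambda>y. case (x, y) of (x, y) \<Rightarrow> f x * g y) has_sum f x * b) B" for x
    using has_sum_cmult_right[OF g, of "f x"] by simp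
  show "((\<lambda>x. f x * b) has_sum a * b) A"
    using has_sum_cmult_left[OF f, of b] .
  have f': "(\<lambda>x. norm (f x)) summable_on A" and g': "(\<lambda>y. norm (g y)) summable_on B"
    using f g by (auto simp flip: summable_on_iff_abs_summable_on_complex intro: has_sum_imp_summable)
  have "(\<lambda>p. norm (case p of (x, y) \<Rightarrow> f x * g y)) summable_on A \<times> B"
    unfolding Infinite_Sum.abs_summable_on_Sigma_iff
  proof (intro conjI ballI)
    show "(\<lambda>y. norm (case (x, y) of (x, y) \<Rightarrow> f x * g y)) summable_on B" for x
      using summable_on_cmult_right[OF g', of "norm (f x)"] by (simp add: norm_mult)
    have "(\<lambda>x. norm (f x) * (\<Sum>\<^sub>\<infinity>y\<in>B. norm (g y))) summable_on A"
      by (intro summable_on_cmult_left f')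
    then show "(\<lambda>x. norm (\<Sum>\<^sub>\<infinity>y\<in>B. norm (case (x, y) of (x, y) \<Rightarrow> f x * g y))) summable_on A"
      using g' by (simp add: norm_mult infsum_cmult_right infsum_nonneg abs_mult)
  qed
  then show "(\<lambda>(x, y). f x * g y) summable_on A \<times> B"
    by (rule Infinite_Sum.abs_summable_summable)
qed

section \<open>Principal minors and matrices of rank two\<close>

lemma minor_empty: "minor {} M = 1"
  by (simp add: minor_def)

lemma minor_singleton: "minor {i} M = M i i"
  by (simp add: minor_def)

lemma minor_doubleton:
  assumes "i \<noteq> j"
  shows "minor {i, j} M = M i i * M j j - M i j * M j i"
proof -
  have "{p. p permutes {i, j}} = {id, Transposition.transpose i j}"
    by (auto simp: permutes_doubleton_iff)
  moreover have "id \<noteq> Transposition.transpose i j"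
    using assms by (metis id_apply transpose_apply_first)
  ultimately show ?thesis
    using assms by (simp add: minor_def sign_swap_id)
qed

text \<open>Expand every row multilinearly into its two rank one summands. Among three rows two must
  use the same summand; they are proportional, so that part of the expansion vanishes.\<close>

lemma minor_rank_two:
  fixes a b c d :: "nat \<Rightarrow> complex"
  assumes S: "finite S" "card S \<ge> 3"
    and M: "\<And>i j. i \<in> S \<Longrightarrow> j \<in> S \<Longrightarrow> M i j = a i * b j + c i * d j"
  shows "minor S M = 0"
proof -
  let ?P = "{p. p permutes S}"
  \<comment> \<open>\<open>X\<close> is the set of rows that take the first summand;
    \<open>h X i\<close> is the column factor of row \<open>i\<close>.\<close>
  define h :: "nat set \<Rightarrow> nat \<Rightarrow> nat \<Rightarrow> complex" where "h X i = (if i \<in> X then b else d)" for X i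
  have expand: "(\<Prod>i\<in>S. M i (p i)) = (\<Sum>X\<in>Pow S. (prod a X * prod c (S - X)) * (\<Prod>i\<in>S. h X i (p i)))"
    if p: "p permutes S" for p
  proof -
    have "(\<Prod>i\<in>S. M i (p i)) = (\<Prod>i\<in>S. a i * b (p i) + c i * d (p i))"
      using p by (intro prod.cong refl M) (auto simp: permutes_in_image)
    also have "\<dots> = (\<Sum>X\<in>Pow S. (\<Prod>i\<in>X. a i * b (p i)) * (\<Prod>i\<in>S - X. c i * d (p i)))"
      by (rule prod_add[OF S(1)])
    also have "\<dots> = (\<Sum>X\<in>Pow S. (prod a X * prod c (S - X)) * (\<Prod>i\<in>S. h X i (p i)))"
    proof (rule sum.cong[OF refl])
      fix X assume "X \<in> Pow S"
      then have X: "X \<subseteq> S"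
        by simp
      have "(\<Prod>i\<in>S. h X i (p i)) = (\<Prod>i\<in>S - X. h X i (p i)) * (\<Prod>i\<in>X. h X i (p i))"
        by (rule prod.subset_diff[OF X S(1)])
      also have "\<dots> = (\<Prod>i\<in>S - X. d (p i)) * (\<Prod>i\<in>X. b (p i))"
        by (simp add: h_def)
      finally show "(\<Prod>i\<in>X. a i * b (p i)) * (\<Prod>i\<in>S - X. c i * d (p i))
          = (prod a X * prod c (S - X)) * (\<Prod>i\<in>S. h X i (p i))"
        by (simp add: prod.distrib mult_ac)
    qed
    finally show ?thesis .
  qed
  have zero: "(\<Sum>p\<in>?P. of_int (sign p) * (\<Prod>i\<in>S. h X i (p i))) = 0" for X
  proof -
    have "\<exists>x\<in>S. \<exists>y\<in>S. x \<noteq> y \<and> (x \<in> X \<longleftrightarrow> y \<in> X)"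
    proof (rule ccontr)
      assume none: "\<not> ?thesis"
      have "inj_on (\<lambda>x. x \<in> X) S"
        using none by (auto simp: inj_on_def)
      then have "card S \<le> card (UNIV :: bool set)"
        by (metis card_inj_on_le finite top_greatest)
      then show False
        using S(2) by simp
    qed
    then obtain x y where xy: "x \<in> S" "y \<in> S" "x \<noteq> y" and same: "x \<in> X \<longleftrightarrow> y \<in> X"
      by blast
    \<comment> \<open>Swapping two rows taken from the same rank one summand changes only the sign.\<close>
    let ?t = "Transposition.transpose x y"
    have t: "?t permutes S"
      using xy by (intro permutes_swap_id)
    have h: "h X (?t i) = h X i" for i
      using same by (cases "i = x"; cases "i = y") (auto simp: h_def)
    have "(\<Sum>p\<in>?P. of_int (sign p) * (\<Prod>i\<in>S. h X i (p i)))
        = (\<Sum>p\<in>?P. of_int (sign (p \<circ> ?t)) * (\<Prod>i\<in>S. h X i ((p \<circ> ?t) i)))"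
      by (rule sum_permutations_compose_right[OF t])
    also have "\<dots> = (\<Sum>p\<in>?P. - (of_int (sign p) * (\<Prod>i\<in>S. h X i (p i))))"
    proof (rule sum.cong[OF refl])
      fix p assume "p \<in> ?P"
      then have "permutation p" "permutation ?t"
        using S(1) t permutation_permutes by blast+
      then have "sign (p \<circ> ?t) = - sign p"
        using xy by (simp add: sign_compose sign_swap_id)
      moreover have "(\<Prod>i\<in>S. h X i ((p \<circ> ?t) i)) = (\<Prod>i\<in>S. h X i (p i))"
        using prod.permute[OF t, of "\<lambda>i. h X i (p i)"] by (simp add: o_def h)
      ultimately show "of_int (sign (p \<circ> ?t)) * (\<Prod>i\<in>S. h X i ((p \<circ> ?t) i))
          = - (of_int (sign p) * (\<Prod>i\<in>S. h X i (p i)))"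
        by simp
    qed
    finally show ?thesis
      by (simp add: sum_negf eq_neg_iff_add_eq_0 flip: mult_2)
  qed
  have "minor S M = (\<Sum>p\<in>?P. \<Sum>X\<in>Pow S. (prod a X * prod c (S - X)) *
      (of_int (sign p) * (\<Prod>i\<in>S. h X i (p i))))"
    unfolding minor_def by (intro sum.cong refl) (simp add: expand sum_distrib_left mult_ac)
  also have "\<dots> = (\<Sum>X\<in>Pow S. (prod a X * prod c (S - X)) *
      (\<Sum>p\<in>?P. of_int (sign p) * (\<Prod>i\<in>S. h X i (p i))))"
    by (subst sum.swap) (simp add: sum_distrib_left)
  finally show ?thesis
    by (simp add: zero)
qed

lemma infsum_singletons:
  fixes f :: "nat set \<Rightarrow> complex"
  shows "(\<Sum>\<^sub>\<infinity>S\<in>{S. S \<subseteq> {1..} \<and> finite S \<and> card S = 1}. f S) = (\<Sum>\<^sub>\<infinity>i\<in>{1..}. f {i})"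
proof -
  have "{S. S \<subseteq> {1..} \<and> finite S \<and> card S = 1} = (\<lambda>i. {i}) ` {1..}"
    by (auto simp: card_1_singleton_iff)
  moreover have "inj_on (\<lambda>i. {i}) {1::nat..}"
    by (simp add: inj_on_def)
  ultimately show ?thesis
    using infsum_reindex[of "\<lambda>i. {i}" "{1::nat..}" f] unfolding o_def by metis
qed

text \<open>Two-element sets correspond to pairs with \<open>i < j\<close>; by symmetry and the
  vanishing diagonal, the full double sum counts each of them twice.\<close>

lemma infsum_doubletons:
  fixes g :: "nat \<Rightarrow> nat \<Rightarrow> complex"
  assumes f: "\<And>i j. i \<ge> 1 \<Longrightarrow> j \<ge> 1 \<Longrightarrow> i \<noteq> j \<Longrightarrow> f {i, j} = g i j"
    and sym: "\<And>i j. g i j = g j i" and diag: "\<And>i. g i i = 0"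
    and g: "((\<lambda>(i, j). g i j) has_sum s) ({1..} \<times> {1..})"
  shows "(\<Sum>\<^sub>\<infinity>S\<in>{S. S \<subseteq> {1..} \<and> finite S \<and> card S = 2}. f S) = s / 2"
proof -
  let ?L = "{(i, j). 1 \<le> i \<and> i < j} :: (nat \<times> nat) set"
  let ?U = "{(i, j). 1 \<le> j \<and> j < i} :: (nat \<times> nat) set"
  let ?g = "\<lambda>(i, j). g i j"
  have summ: "?g summable_on {1..} \<times> {1..}"
    using g by (rule has_sum_imp_summable)
  have L: "?g summable_on ?L" and U: "?g summable_on ?U"
    by (rule summable_on_subset[OF summ]; auto)+
  have "infsum ?g ({1..} \<times> {1..}) = infsum ?g (?L \<union> ?U)"
    by (rule infsum_cong_neutral) (auto simp: diag not_less_iff_gr_or_eq)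
  also have "\<dots> = infsum ?g ?L + infsum ?g ?U"
    by (rule infsum_Un_disjoint[OF L U]) auto
  also have "infsum ?g ?U = infsum ?g ?L"
    by (rule infsum_reindex_bij_witness[of _ "\<lambda>(i, j). (j, i)" "\<lambda>(i, j). (j, i)"])
      (auto simp: sym)
  finally have "s = 2 * infsum ?g ?L"
    using infsumI[OF g] by simp
  moreover have "infsum f {S. S \<subseteq> {1..} \<and> finite S \<and> card S = 2} = infsum ?g ?L"
  proof (rule infsum_reindex_bij_witness[of _ "\<lambda>(i, j). {i, j}" "\<lambda>S. (Min S, Max S)"])
    fix S :: "nat set" assume S: "S \<in> {S. S \<subseteq> {1..} \<and> finite S \<and> card S = 2}"
    then obtain x y where xy: "S = {x, y}" "x < y"
      by (metis (mono_tags, lifting) card_2_iff insert_commute linorder_neqE_nat mem_Collect_eq)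
    then show "(case (Min S, Max S) of (i, j) \<Rightarrow> {i, j}) = S" "(Min S, Max S) \<in> ?L"
      using S by auto
    show "?g (Min S, Max S) = f S"
      using xy S f[of x y] by auto
  next
    fix p assume p: "p \<in> ?L"
    then show "(Min (case p of (i, j) \<Rightarrow> {i, j}), Max (case p of (i, j) \<Rightarrow> {i, j})) = p"
      "(case p of (i, j) \<Rightarrow> {i, j}) \<in> {S. S \<subseteq> {1..} \<and> finite S \<and> card S = 2}"
      by auto
  qed
  ultimately show ?thesis
    by simp
qed

section \<open>The matrix of the relative operator and its determinant\<close>

lemma ell2_inner_basis:
  assumes "i \<ge> 1"
  shows "ell2_inner (ell2_basis i) x = x i"
proof -
  have "ell2_inner (ell2_basis i) x = (\<Sum>\<^sub>\<infinity>n\<in>{i}. x n)"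
    unfolding ell2_inner_def using assms
    by (intro infsum_cong_neutral) (auto simp: ell2_basis_def)
  then show ?thesis
    by simp
qed

lemma id_minus_opT: "id_minus z opT x n = x n * (1 - z / of_nat n)"
  by (simp add: id_minus_def opT_def algebra_simps)

text \<open>The operator is diagonal with nonzero entries \<open>1 - z / n\<close>, hence injective
  on \<open>ell2\<close>, where the coordinate 0 is fixed to be zero. Injectivity makes
  \<open>inv_into\<close> the true inverse on its image.\<close>

lemma inv_id_minus_opT_basis:
  assumes z: "z \<notin> of_nat ` {1..}" and j: "j \<ge> 1"
  shows "inv_into ell2 (id_minus z opT) (ell2_basis j) = (\<lambda>n. 1 / (1 - z / of_nat j) * ell2_basis j n)"
proof (rule inv_into_f_eq)
  have nz: "1 - z / of_nat n \<noteq> 0" if "n \<ge> 1" for n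
    using z that by (auto simp: field_simps)
  show "inj_on (id_minus z opT) ell2"
  proof (rule inj_onI, rule ext)
    fix x y n assume xy: "x \<in> ell2" "y \<in> ell2" "id_minus z opT x = id_minus z opT y"
    show "x n = y n"
    proof (cases "n \<ge> 1")
      case True
      then show ?thesis
        using nz[OF True] fun_cong[OF xy(3), of n] by (simp add: id_minus_opT)
    qed (use xy in \<open>auto simp: ell2_def not_le\<close>)
  qed
  let ?y = "\<lambda>n. 1 / (1 - z / of_nat j) * ell2_basis j n"
  have "(\<lambda>n. (cmod (?y n))\<^sup>2) summable_on {1..}"
    by (rule finite_nonzero_values_imp_summable_on, rule finite_subset[of _ "{j}"])
      (auto simp: ell2_basis_def)
  then show "?y \<in> ell2"
    using j by (simp add: ell2_def ell2_basis_def)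
  show "id_minus z opT ?y = ell2_basis j"
    using nz[OF j] by (auto simp: fun_eq_iff id_minus_opT ell2_basis_def)
qed

lemma has_sum_diff:
  fixes f g :: "'i \<Rightarrow> complex"
  assumes "(f has_sum a) A" "(g has_sum b) A"
  shows "((\<lambda>x. f x - g x) has_sum a - b) A"
  using has_sum_add[OF assms(1) has_sum_uminusI[OF assms(2)]] by simp

lemma vec_u_eq: "vec_u n = of_real (sqrt (gregory_weight n))"
  by (simp add: vec_u_def gregory_weight_def)

lemma vec_u_mult_self: "vec_u n * vec_u n = of_real (gregory_weight n)"
  unfolding vec_u_eq of_real_mult[symmetric] using gregory.nonneg by simp

lemma cnj_vec_u: "cnj (vec_u n) = vec_u n"
  by (simp add: vec_u_eq)

lemma has_sum_gregory_weight:
  fixes f :: "nat \<Rightarrow> complex"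
  assumes "\<And>n. n \<ge> 1 \<Longrightarrow> norm (f n) \<le> C"
  shows "((\<lambda>n. of_real (gregory_weight n) * f n) has_sum (\<Sum>n. of_real (gregory_weight n) * f n)) {1..}"
proof -
  have "norm (of_real (gregory_weight n) * f n) \<le> gregory_weight n * C" for n
    using assms[of n] gregory.w_0 gregory.nonneg[of n]
    by (cases "n = 0") (auto simp: norm_mult mult_left_mono)
  then have s: "summable (\<lambda>n. norm (of_real (gregory_weight n) * f n))"
    by (intro summable_comparison_test'[OF summable_mult2[OF gregory.summable_w, of C], of 0])
      (simp only: real_norm_def abs_norm_cancel)
  then have "((\<lambda>n. of_real (gregory_weight n) * f n) has_sum (\<Sum>n. of_real (gregory_weight n) * f n)) UNIV"
    by (intro norm_summable_imp_has_sum summable_sums summable_norm_cancel[OF s])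
  moreover have "of_real (gregory_weight n) * f n = 0" if "n \<in> UNIV - {1..}" for n
    using that gregory.w_0 by (cases n) auto
  ultimately show ?thesis
    by (subst has_sum_cong_neutral[of UNIV "{1..}"]) auto
qed

text \<open>Since \<open>u\<close> is real of norm one, pairing \<open>x - b u\<close> with
  \<open>a u\<close> gives \<open>cnj a * (c - b)\<close>; orthogonality forces
  \<open>b = c\<close>.\<close>

lemma opQ_eq:
  assumes x: "((\<lambda>n. vec_u n * x n) has_sum c) {1..}"
  shows "opQ x = (\<lambda>n. c * vec_u n)"
proof -
  have "(\<Sum>n. of_real (gregory_weight n) * 1) = (1 :: complex)"
    using sums_of_real[OF gregory.w_sums, where 'a = complex] by (simp add: sums_iff)
  then have u: "((\<lambda>n. vec_u n * vec_u n) has_sum 1) {1..}"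
    using has_sum_gregory_weight[of "\<lambda>_. 1" 1] by (simp add: vec_u_mult_self)
  have inner: "ell2_inner (\<lambda>n. a * vec_u n) (x - (\<lambda>n. b * vec_u n)) = cnj a * (c - b)" for a b
  proof -
    have "((\<lambda>n. cnj a * (vec_u n * x n - b * (vec_u n * vec_u n))) has_sum cnj a * (c - b * 1)) {1..}"
      by (intro has_sum_cmult_right has_sum_diff x u)
    then show ?thesis
      unfolding ell2_inner_def by (intro infsumI) (simp add: cnj_vec_u algebra_simps)
  qed
  show ?thesis
    unfolding opQ_def orth_proj_def
  proof (rule the_equality)
    show "(\<lambda>n. c * vec_u n) \<in> range (\<lambda>c n. c * vec_u n) \<and>
        (\<forall>v\<in>range (\<lambda>c n. c * vec_u n). ell2_inner v (x - (\<lambda>n. c * vec_u n)) = 0)"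
      by (auto simp: inner)
  next
    fix y
    assume y: "y \<in> range (\<lambda>c n. c * vec_u n) \<and>
      (\<forall>v\<in>range (\<lambda>c n. c * vec_u n). ell2_inner v (x - y) = 0)"
    then obtain b where b: "y = (\<lambda>n. b * vec_u n)"
      by blast
    moreover have "ell2_inner (\<lambda>n. 1 * vec_u n) (x - y) = 0"
      using y by blast
    ultimately show "y = (\<lambda>n. c * vec_u n)"
      by (simp only: inner) simp
  qed
qed

text \<open>The inner product of \<open>u\<close> with \<open>T u\<close>, through which
  \<open>QTQ\<close> enters the matrix.\<close>

definition mean_inverse :: complex where
  "mean_inverse = (\<Sum>n. of_real (gregory_weight n) * (1 / of_nat n))"

lemma norm_inverse_nat_le: "n \<ge> 1 \<Longrightarrow> norm (1 / of_nat n :: complex) \<le> 1"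
  by (simp add: norm_divide)

lemma has_sum_mean_inverse:
  "((\<lambda>n. of_real (gregory_weight n) * (1 / of_nat n)) has_sum mean_inverse) {1..}"
  unfolding mean_inverse_def by (rule has_sum_gregory_weight[OF norm_inverse_nat_le])

text \<open>Expand \<open>PTP = T - QT - TQ + QTQ\<close>: the three correction terms give
  \<open>1 / j\<close>, \<open>1 / i\<close> and \<open>mean_inverse\<close>, each times
  \<open>u i * u j\<close>. The scalar \<open>c\<close> is carried along because the inverse maps
  basis vectors to multiples of themselves.\<close>

lemma opT_perp_basis:
  assumes j: "j \<ge> 1"
  shows "opT_perp (\<lambda>n. c * ell2_basis j n) i =
    c * (ell2_basis j i / of_nat i - vec_u i * vec_u j * (1 / of_nat i + 1 / of_nat j - mean_inverse))"
proof -
  have basis_sum: "((\<lambda>n. f n * ell2_basis j n) has_sum f j) {1..}" for f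
    by (rule has_sum_finite_neutralI[of "{j}"]) (use j in \<open>auto simp: ell2_basis_def\<close>)
  have "opQ (\<lambda>n. c * ell2_basis j n) = (\<lambda>n. c * vec_u j * vec_u n)"
    using basis_sum[of "\<lambda>n. vec_u n * c"] by (intro opQ_eq) (simp add: mult_ac)
  then have P: "opP (\<lambda>n. c * ell2_basis j n) = (\<lambda>n. c * ell2_basis j n - c * vec_u j * vec_u n)"
    by (simp add: opP_def fun_eq_iff)
  have T: "opT (opP (\<lambda>n. c * ell2_basis j n))
      = (\<lambda>n. c * (ell2_basis j n / of_nat n) - c * vec_u j * (vec_u n / of_nat n))"
    unfolding P by (simp add: opT_def fun_eq_iff diff_divide_distrib)
  have "((\<lambda>n. c * (vec_u n / of_nat n * ell2_basis j n)
      - c * vec_u j * (of_real (gregory_weight n) * (1 / of_nat n))) has_sum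
      c * (vec_u j / of_nat j) - c * vec_u j * mean_inverse) {1..}"
    by (intro has_sum_diff has_sum_cmult_right basis_sum has_sum_mean_inverse)
  then have "((\<lambda>n. vec_u n * opT (opP (\<lambda>n. c * ell2_basis j n)) n) has_sum
      c * (vec_u j / of_nat j) - c * vec_u j * mean_inverse) {1..}"
    unfolding T vec_u_mult_self[symmetric] by (simp add: algebra_simps)
  from opQ_eq[OF this] show ?thesis
    unfolding opT_perp_def o_def opP_def[of "opT _"] by (simp add: T algebra_simps)
qed

lemma relative_matrix:
  assumes z: "z \<notin> of_nat ` {1..}" and i: "i \<ge> 1" and j: "j \<ge> 1"
  shows "ell2_inner (ell2_basis i)
      ((id_minus z opT_perp \<circ> inv_into ell2 (id_minus z opT)) (ell2_basis j) - ell2_basis j)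
    = vec_u i * vec_u j * (z / (1 - z / of_nat j)) * (1 / of_nat i + 1 / of_nat j - mean_inverse)"
proof -
  have nz: "1 - z / of_nat j \<noteq> 0"
    using z j by (auto simp: field_simps)
  define c where "c = 1 / (1 - z / of_nat j)"
  have "c * (1 - z / of_nat j) = 1"
    using nz by (simp add: c_def)
  \<comment> \<open>The diagonal part \<open>I - z T\<close> undoes the scaling by \<open>c\<close>,
    so after subtracting the identity only the finite rank term survives.\<close>
  then have c: "c * ell2_basis j i - z * (c * (ell2_basis j i / of_nat i)) = ell2_basis j i"
    by (cases "i = j") (auto simp: ell2_basis_def algebra_simps)
  have "(id_minus z opT_perp (\<lambda>n. c * ell2_basis j n) - ell2_basis j) i
      = (c * ell2_basis j i - z * (c * (ell2_basis j i / of_nat i))) - ell2_basis j i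
        + vec_u i * vec_u j * (z * c) * (1 / of_nat i + 1 / of_nat j - mean_inverse)"
    unfolding fun_diff_def id_minus_def opT_perp_basis[OF j] by (simp add: algebra_simps)
  then have "(id_minus z opT_perp (\<lambda>n. c * ell2_basis j n) - ell2_basis j) i
      = vec_u i * vec_u j * (z * c) * (1 / of_nat i + 1 / of_nat j - mean_inverse)"
    unfolding c by simp
  then show ?thesis
    unfolding ell2_inner_basis[OF i] o_def inv_id_minus_opT_basis[OF z j] by (simp add: c_def)
qed

text \<open>The minors of sizes one and two sum to \<open>2 * m 1 - mean_inverse * m 0\<close> and
  \<open>(m 1)\<^sup>2 - m 0 * m 2\<close>. Two recurrences between consecutive moments eliminate
  \<open>m 0\<close> and \<open>m 2\<close>.\<close>

theorem relative_det_eq_stieltjes: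
  assumes z: "z \<notin> of_nat ` {1..}"
  shows "relative_det z = stieltjes gregory_weight z"
proof -
  define d where "d j = z / (1 - z / of_nat j)" for j :: nat
  define K where "K i j = vec_u i * vec_u j * d j * (1 / of_nat i + 1 / of_nat j - mean_inverse)"
    for i j :: nat
  define f where "f k n = d n * (1 / of_nat n) ^ k" for k n :: nat
  define m where "m k = (\<Sum>n. of_real (gregory_weight n) * f k n)" for k
  let ?w = "\<lambda>n. complex_of_real (gregory_weight n)"
  obtain e C where "e > 0" "cball z e \<inter> of_nat ` {1..} = {}"
    and "\<And>n y. y \<in> cball z e \<Longrightarrow> norm (of_nat n / (of_nat n - y)) \<le> C"
    using kernel_bound[OF z] by blast
  then have C: "norm (of_nat n / (of_nat n - z)) \<le> C" for n
    by (metis centre_in_cball less_imp_le)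
  have off: "of_nat n - z \<noteq> 0" "of_nat n \<noteq> (0 :: complex)" if "n \<ge> 1" for n
    using z that by auto
  have d: "d n = z * (of_nat n / (of_nat n - z))" if "n \<ge> 1" for n
    using off[OF that] by (simp add: d_def field_simps)
  have fb: "norm (f k n) \<le> norm z * C" if n: "n \<ge> 1" for k n
  proof -
    have "norm (f k n) = norm z * norm (of_nat n / (of_nat n - z)) * norm (1 / of_nat n :: complex) ^ k"
      unfolding f_def d[OF n] norm_mult norm_power ..
    also have "\<dots> \<le> norm z * C * 1"
      using C[of n] norm_inverse_nat_le[OF n] order_trans[OF norm_ge_zero C[of n]]
      by (intro mult_mono power_le_one) auto
    finally show ?thesis
      by simp
  qed
  have m: "((\<lambda>n. ?w n * f k n) has_sum m k) {1..}" for k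
    unfolding m_def by (rule has_sum_gregory_weight[OF fb])
  have one: "((\<lambda>n. ?w n * 1) has_sum 1) {1..}"
    using has_sum_gregory_weight[of "\<lambda>_. 1" 1] sums_of_real[OF gregory.w_sums, where 'a = complex]
    by (simp add: sums_iff)
  \<comment> \<open>All three identities come from \<open>d n * (1 - z / n) = z\<close>.\<close>
  have rec: "f 0 n = z * 1 + z * f 1 n" "f 1 n = z * (1 / of_nat n) + z * f 2 n"
    and st: "of_nat n / (of_nat n - z) = 1 + f 1 n" if "n \<ge> 1" for n
    using off[OF that] by (auto simp: f_def d[OF that] field_simps power2_eq_square)
  have m0: "m 0 = z + z * m 1"
  proof -
    have "((\<lambda>n. z * (?w n * 1) + z * (?w n * f 1 n)) has_sum z * 1 + z * m 1) {1..}"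
      by (intro has_sum_add has_sum_cmult_right one m)
    also have "?this \<longleftrightarrow> ((\<lambda>n. ?w n * f 0 n) has_sum z * 1 + z * m 1) {1..}"
      by (intro has_sum_cong) (simp add: rec algebra_simps)
    finally show ?thesis
      using has_sum_unique[OF m] by simp
  qed
  have m1: "m 1 = z * mean_inverse + z * m 2"
  proof -
    have "((\<lambda>n. z * (?w n * (1 / of_nat n)) + z * (?w n * f 2 n)) has_sum z * mean_inverse + z * m 2) {1..}"
      by (intro has_sum_add has_sum_cmult_right has_sum_mean_inverse m)
    also have "?this \<longleftrightarrow> ((\<lambda>n. ?w n * f 1 n) has_sum z * mean_inverse + z * m 2) {1..}"
      by (intro has_sum_cong) (simp only: rec atLeast_iff, simp add: algebra_simps)
    finally show ?thesis
      using has_sum_unique[OF m] by simp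
  qed
  have stieltjes: "stieltjes gregory_weight z = 1 + m 1"
  proof -
    have "((\<lambda>n. ?w n * (of_nat n / (of_nat n - z))) has_sum stieltjes gregory_weight z) {1..}"
      unfolding stieltjes_def by (rule has_sum_gregory_weight[OF C])
    also have "?this \<longleftrightarrow> ((\<lambda>n. ?w n * 1 + ?w n * f 1 n) has_sum stieltjes gregory_weight z) {1..}"
      by (intro has_sum_cong) (simp only: st atLeast_iff distrib_left)
    finally show ?thesis
      using has_sum_unique[OF _ has_sum_add[OF one m]] by simp
  qed
  define A where "A = id_minus z opT_perp \<circ> inv_into ell2 (id_minus z opT)"
  let ?F = "\<lambda>k. {S. S \<subseteq> {1..} \<and> finite S \<and> card S = k} :: nat set set"
  let ?M = "\<lambda>i j. ell2_inner (ell2_basis i) (A (ell2_basis j) - ell2_basis j)"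
  have M: "?M i j = K i j" if "i \<ge> 1" "j \<ge> 1" for i j
    using relative_matrix[OF z that] by (simp add: K_def d_def A_def)
  define c where "c k = (\<Sum>\<^sub>\<infinity>S\<in>?F k. minor S ?M)" for k
  have "?F 0 = {{}}"
    by auto
  then have c0: "c 0 = 1"
    by (simp add: c_def minor_empty)
  have c1: "c 1 = 2 * m 1 - mean_inverse * m 0"
  proof -
    have "c 1 = (\<Sum>\<^sub>\<infinity>i\<in>{1..}. 2 * (?w i * f 1 i) - mean_inverse * (?w i * f 0 i))"
      unfolding c_def infsum_singletons minor_singleton
      by (intro infsum_cong) (simp add: M K_def f_def vec_u_mult_self[symmetric] algebra_simps)
    also have "\<dots> = 2 * m 1 - mean_inverse * m 0"
      by (intro infsumI has_sum_diff has_sum_cmult_right m)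
    finally show ?thesis .
  qed
  have c2: "c 2 = (m 1)\<^sup>2 - m 0 * m 2"
  proof -
    define g where "g i j = - (?w i * ?w j * d i * d j * (1 / of_nat i - 1 / of_nat j)\<^sup>2)" for i j
    \<comment> \<open>In a minor of size two \<open>mean_inverse\<close> cancels: \<open>(2 p - t)
      (2 q - t) - (p + q - t)\<^sup>2 = - (p - q)\<^sup>2\<close>.\<close>
    have alg: "u * u * a * (p + p - t) * (v * v * b * (q + q - t))
        - u * v * b * (p + q - t) * (v * u * a * (q + p - t)) = - (u * u * (v * v) * a * b * (p - q)\<^sup>2)"
      for u v a b p q t :: complex
      by (simp add: power2_eq_square algebra_simps)
    have "c 2 = (2 * (m 1 * m 1) - (m 2 * m 0 + m 0 * m 2)) / 2"
      unfolding c_def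
    proof (rule infsum_doubletons)
      show "minor {i, j} ?M = g i j" if "i \<ge> 1" "j \<ge> 1" "i \<noteq> j" for i j
        unfolding minor_doubleton[OF that(3)] M[OF that(1,2)] M[OF that(2,1)] M[OF that(1,1)] M[OF that(2,2)]
        unfolding K_def g_def vec_u_mult_self[symmetric]
        by (rule alg)
      show "g i j = g j i" for i j
        by (simp add: g_def power2_commute[of "1 / of_nat i"] mult_ac)
      show "g i i = 0" for i
        by (simp add: g_def)
      have p: "((\<lambda>(i, j). (?w i * f k i) * (?w j * f l j)) has_sum m k * m l) ({1..} \<times> {1..})" for k l
        by (rule has_sum_product_complex[OF m m])
      \<comment> \<open>Expanding the square \<open>(1 / i - 1 / j)\<^sup>2\<close> splits the
        double sum into products of moments.\<close>
      have "((\<lambda>q. 2 * (case q of (i, j) \<Rightarrow> (?w i * f 1 i) * (?w j * f 1 j))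
          - ((case q of (i, j) \<Rightarrow> (?w i * f 2 i) * (?w j * f 0 j))
            + (case q of (i, j) \<Rightarrow> (?w i * f 0 i) * (?w j * f 2 j))))
          has_sum 2 * (m 1 * m 1) - (m 2 * m 0 + m 0 * m 2)) ({1..} \<times> {1..})"
        by (intro has_sum_diff has_sum_add has_sum_cmult_right p)
      also have "(\<lambda>q. 2 * (case q of (i, j) \<Rightarrow> (?w i * f 1 i) * (?w j * f 1 j))
          - ((case q of (i, j) \<Rightarrow> (?w i * f 2 i) * (?w j * f 0 j))
            + (case q of (i, j) \<Rightarrow> (?w i * f 0 i) * (?w j * f 2 j)))) = (\<lambda>(i, j). g i j)"
        by (auto simp: fun_eq_iff g_def f_def power2_eq_square algebra_simps)
      finally show "((\<lambda>(i, j). g i j) has_sum 2 * (m 1 * m 1) - (m 2 * m 0 + m 0 * m 2)) ({1..} \<times> {1..})" .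
    qed
    then show ?thesis
      unfolding power2_eq_square mult.commute[of "m 2" "m 0"] by (simp add: diff_divide_distrib)
  qed
  \<comment> \<open>The rank two form: \<open>1 / i + 1 / j - mean_inverse\<close> is a function of
    \<open>j\<close> alone plus \<open>1 / i\<close>.\<close>
  have "minor S ?M = 0" if "S \<in> ?F k" "k \<ge> 3" for S k
  proof (rule minor_rank_two[where a = vec_u and c = "\<lambda>i. vec_u i / of_nat i"
        and b = "\<lambda>j. vec_u j * d j * (1 / of_nat j - mean_inverse)" and d = "\<lambda>j. vec_u j * d j"])
    show "?M i j = vec_u i * (vec_u j * d j * (1 / of_nat j - mean_inverse))
        + vec_u i / of_nat i * (vec_u j * d j)" if "i \<in> S" "j \<in> S" for i j
    proof -
      have "i \<ge> 1" "j \<ge> 1"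
        using that \<open>S \<in> ?F k\<close> by auto
      then show ?thesis
        by (simp add: M K_def algebra_simps)
    qed
  qed (use that in auto)
  then have ck: "c k = 0" if "k \<ge> 3" for k
    unfolding c_def using that by (intro infsum_0) blast
  have "relative_det z = (\<Sum>k. c k)"
    unfolding relative_det_def fredholm_det_def c_def A_def ..
  also have "\<dots> = (\<Sum>k\<in>{0, 1, 2}. c k)"
    by (rule suminf_finite) (auto intro!: ck)
  also have "\<dots> = 1 + (2 * m 1 - mean_inverse * m 0) + ((m 1)\<^sup>2 - m 0 * m 2)"
    using c0 c1 c2 by simp
  \<comment> \<open>Inserting \<open>m 0 = z * (1 + m 1)\<close> makes \<open>1 + m 1\<close> a
    common factor; the bracket that remains is \<open>m 1\<close> by the second recurrence.\<close>
  also have "\<dots> = (1 + m 1)\<^sup>2 - (1 + m 1) * (z * mean_inverse + z * m 2)"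
    unfolding m0 by (simp add: power2_eq_square algebra_simps)
  also have "\<dots> = 1 + m 1"
    unfolding m1[symmetric] by (simp add: power2_eq_square algebra_simps)
  finally show ?thesis
    using stieltjes by simp
qed

theorem theorem7p2:
  "\<forall>z::complex. z \<notin> of_nat ` {1..} \<longrightarrow>
     relative_det z = gregory_transform z \<and>
     (\<lambda>k. (1 - z / of_real (gregory_zero (Suc k))) / (1 - z / of_nat (Suc k)))
       has_prod gregory_transform z \<and>
     (\<exists>d>0. cball z d \<inter> of_nat ` {1..} = {} \<and>
        uniform_limit (cball z d)
          (\<lambda>N w. \<Prod>n=1..N. (1 - w / of_real (gregory_zero n)) / (1 - w / of_nat n))
          gregory_transform sequentially)"
proof (intro allI impI conjI)
  fix z :: complex
  assume z: "z \<notin> of_nat ` {1..}"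
  show "relative_det z = gregory_transform z"
    unfolding gregory_transform_eq[OF z] by (rule relative_det_eq_stieltjes[OF z])
  show "(\<lambda>k. (1 - z / of_real (gregory_zero (Suc k))) / (1 - z / of_nat (Suc k)))
      has_prod gregory_transform z"
    using gregory.stieltjes_has_prod[OF z]
    by (simp only: gregory_transform_eq[OF z] gregory_zero_eq le_add1 plus_1_eq_Suc[symmetric])
  obtain d where d: "d > 0" and disj: "cball z d \<inter> of_nat ` {1..} = {}"
    and lim: "uniform_limit (cball z d)
      (\<lambda>N y. \<Prod>n=1..N. (1 - y / of_real (gregory.zero n)) / (1 - y / of_nat n))
      (stieltjes gregory_weight) sequentially"
    by (rule gregory.stieltjes_product_uniform[OF z])
  have "uniform_limit (cball z d)
      (\<lambda>N w. \<Prod>n=1..N. (1 - w / of_real (gregory_zero n)) / (1 - w / of_nat n))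
      gregory_transform sequentially"
  proof (rule uniform_limit_cong'[THEN iffD2, OF _ _ lim])
    show "(\<Prod>n=1..N. (1 - w / of_real (gregory_zero n)) / (1 - w / of_nat n))
        = (\<Prod>n=1..N. (1 - w / of_real (gregory.zero n)) / (1 - w / of_nat n))" for N w
      by (intro prod.cong refl) (simp add: gregory_zero_eq)
    show "gregory_transform w = stieltjes gregory_weight w" if "w \<in> cball z d" for w
      using disj that by (intro gregory_transform_eq) blast
  qed
  with d disj show "\<exists>d>0. cball z d \<inter> of_nat ` {1..} = {} \<and>
      uniform_limit (cball z d)
        (\<lambda>N w. \<Prod>n=1..N. (1 - w / of_real (gregory_zero n)) / (1 - w / of_nat n))
        gregory_transform sequentially"
    by blast
qed

end
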